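(* Let $p\ge2$ and $\mathcal{B}\subset\Sigma_{2\times2}(p)$. Suppose that (i) $\mathbb{H}_2(\mathcal{B})$ and $\mathbb{V}_2(\mathcal{B})$ are non-degenerated, and (ii) both of the following hold. (ii-H) At least one of: (a) there is an $S$-invariant diagonal cycle $\beta_1\beta_2\cdots\beta_q\beta_1$ of some order $(m,q)$ with invariant index set $\mathcal{K}$ such that $\sum_{l\in\mathcal{K}}H^{(l)}_{m,n;\beta_1}$ is primitive for all $2\le n\le q+1$; (b) there is an $H$-primitive commutative cycle pair with index $\langle m,\bar\alpha;K,L\rangle$ such that $(S_{m;\bar\alpha,\bar\alpha})_{K,L}=1$ or $(S_{m;\bar\alpha,\bar\alpha})_{L,K}=1$. (ii-V) At least one of: (a) there is a $W$-invariant diagonal cycle $\beta_1\beta_2\cdots\beta_q\beta_1$ of some order $(m,q)$ with invariant index set $\mathcal{K}$ such that $\sum_{l\in\mathcal{K}}V^{(l)}_{m,n;\beta_1}$ is primitive for all $2\le n\le q+1$; (b) there is a $V$-primitive commutative cycle pair with index $\langle m,\bar\alpha;K,L\rangle$ such that $(W_{m;\bar\alpha,\bar\alpha})_{K,L}=1$ or $(W_{m;\bar\alpha,\bar\alpha})_{L,K}=1$. Then $\Sigma(\mathcal{B})$ is topologically mixing.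
   Context: Patterns. $\mathcal{S}_p=\{0,\dots,p-1\}$. $\mathbb{Z}_{m\times n}((i,j))=\{(i+n_1,j+n_2):0\le n_1\le m-1,0\le n_2\le n-1\}$, $\mathbb{Z}_{m\times n}=\mathbb{Z}_{m\times n}((0,0))$, $\Sigma_{m\times n}(p)=\mathcal{S}_p^{\mathbb{Z}_{m\times n}}$. Given $\mathcal{B}\subset\Sigma_{2\times2}(p)$, a pattern $U\in\mathcal{S}_p^R$, $R\subset\mathbb{Z}^2$, is $\mathcal{B}$-admissible if $U|_{\mathbb{Z}_{2\times2}((i,j))}\in\mathcal{B}$ (after translation) whenever $\mathbb{Z}_{2\times2}((i,j))\subset R$. $\Sigma(\mathcal{B})$ is the set of $\mathcal{B}$-admissible patterns on $\mathbb{Z}^2$. Counting function: $\psi(u_1,\dots,u_n)=1+\sum_{k=1}^nu_kp^{n-k}$ for $u_k\in\mathcal{S}_p$. Transition matrices. For $n\ge2$, $\mathbb{H}_n=\mathbb{H}_n(\mathcal{B})$ is the $p^n\times p^n$ zero-one matrix whose $(i,j)$ entry is $1$ iff the pattern $(u_{s,t})_{0\le s\le1,0\le t\le n-1}$ on $\mathbb{Z}_{2\times n}$ with $i=\psi(u_{0,0},\dots,u_{0,n-1})$, $j=\psi(u_{1,0},\dots,u_{1,n-1})$ is $\mathcal{B}$-admissible. $\mathbb{V}_n=\mathbb{V}_n(\mathcal{B})$ is the $p^n\times p^n$ zero-one matrix whose $(i,j)$ entry is $1$ iff the pattern $(u_{s,t})_{0\le s\le n-1,0\le t\le1}$ on $\mathbb{Z}_{n\times2}$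 with $i=\psi(u_{0,0},\dots,u_{n-1,0})$, $j=\psi(u_{0,1},\dots,u_{n-1,1})$ is $\mathcal{B}$-admissible. Write $\mathbb{H}_n=[H_{n;i,j}]_{1\le i,j\le p}$ and $\mathbb{V}_n=[V_{n;i,j}]_{1\le i,j\le p}$ as $p\times p$ block matrices with blocks of size $p^{n-1}\times p^{n-1}$, and set $H_{n;\alpha}=H_{n;i,j}$, $V_{n;\alpha}=V_{n;i,j}$ for $\alpha=\psi(i-1,j-1)\in\{1,\dots,p^2\}$. A matrix is non-compressible if it has no zero row and no zero column. $\mathbb{H}_2$ (resp. $\mathbb{V}_2$) is non-degenerated if $H_{2;\alpha}$ (resp. $V_{2;\alpha}$) is non-compressible for all $1\le\alpha\le p^2$. A non-negative square matrix $A$ is primitive if there is $N\ge1$ with all entries of $A^n$ positive for all $n\ge N$. Elementary patterns. For $m,n\ge2$, $1\le\alpha\le p^2$, $1\le k\le p^{m-1}$, $H^{(k)}_{m,n;\alpha}=H_{n;j_1,j_2}H_{n;j_2,j_3}\cdots H_{n;j_m,j_{m+1}}$, where $j_1,\dots,j_{m+1}\in\{1,\dots,p\}$ are determined by $\alpha=\psi(j_1-1,j_{m+1}-1)$ and $k=\psi(j_2-1,\dots,j_m-1)$; $V^{(k)}_{m,n;\alpha}=V_{n;j_1,j_2}\cdots V_{n;j_m,j_{m+1}}$ with the same indices. Connecting operators. For $m\ge2$ and $1\le\alpha,\beta\le p^2$, $S_{m;\alpha,\beta}$ is the $p^{m-1}\times p^{m-1}$ zero-one matrix whose $(s,t)$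 entry is $1$ iff the pattern $(u_{a,b})_{0\le a\le m,0\le b\le1}$ on $\mathbb{Z}_{(m+1)\times2}$ with $\alpha=\psi(u_{0,0},u_{m,0})$, $\beta=\psi(u_{0,1},u_{m,1})$, $s=\psi(u_{1,0},\dots,u_{m-1,0})$, $t=\psi(u_{1,1},\dots,u_{m-1,1})$ is $\mathcal{B}$-admissible. $W_{m;\alpha,\beta}$ is the $p^{m-1}\times p^{m-1}$ zero-one matrix whose $(s,t)$ entry is $1$ iff the pattern $(u_{a,b})_{0\le a\le1,0\le b\le m}$ on $\mathbb{Z}_{2\times(m+1)}$ with $\alpha=\psi(u_{0,0},u_{0,m})$, $\beta=\psi(u_{1,0},u_{1,m})$, $s=\psi(u_{0,1},\dots,u_{0,m-1})$, $t=\psi(u_{1,1},\dots,u_{1,m-1})$ is $\mathcal{B}$-admissible. Invariant diagonal cycles. $\mathcal{D}_p=\{1+j(p+1):j\in\mathcal{S}_p\}$. A sequence $\beta_1\beta_2\cdots\beta_q\beta_1$ ($q\ge1$) with all $\beta_j\in\mathcal{D}_p$ is an $S$-invariant diagonal cycle of order $(m,q)$ ($m\ge2$) with invariant index set $\mathcal{K}\subseteq\{1,\dots,p^{m-1}\}$ if $\sum_{k\in\mathcal{K}}(S_{m;\beta_1,\beta_2}S_{m;\beta_2,\beta_3}\cdots S_{m;\beta_q,\beta_1})_{k,l}\ge1$ for all $l\in\mathcal{K}$; it is a $W$-invariant diagonal cycle if the same holds with $W$ in place of $S$. Commutative cycle pairs. For $q,q'\ge1$ let $I_q=i_1i_2\cdots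 i_qi_1$ and $J_{q'}=j_1j_2\cdots j_{q'}j_1$ be cycles with entries in $\{1,\dots,p\}$ and $j_1=i_1$. The pair $(I_qJ_{q'})=i_1i_2\cdots i_qi_1j_2\cdots j_{q'}i_1$ and $(J_{q'}I_q)=i_1j_2\cdots j_{q'}i_1i_2\cdots i_qi_1$ is a commutative cycle pair; its index is $\langle m,\bar\alpha;K,L\rangle$ with $m=q+q'$, $\bar\alpha=\psi(i_1-1,i_1-1)$, $K=\psi(i_2-1,\dots,i_q-1,i_1-1,j_2-1,\dots,j_{q'}-1)$, $L=\psi(j_2-1,\dots,j_{q'}-1,i_1-1,i_2-1,\dots,i_q-1)$. It is $H$-primitive if $H^{(K)}_{m,2;\bar\alpha}$ and $H^{(L)}_{m,2;\bar\alpha}$ are primitive, and $V$-primitive if $V^{(K)}_{m,2;\bar\alpha}$ and $V^{(L)}_{m,2;\bar\alpha}$ are primitive. Topological mixing. $\Pi_R$ denotes restriction to $R$, $\Pi_R(\Sigma)$ its image on $\Sigma$, $d$ Euclidean distance. $\Sigma\subset\mathcal{S}_p^{\mathbb{Z}^2}$ is topologically mixing if for any finite $R_1,R_2\subset\mathbb{Z}^2$ there is a constant $M(R_1,R_2)$ such that for all $\mathbf{v}\in\mathbb{Z}^2$ with $d(R_1,R_2+\mathbf{v})\ge M(R_1,R_2)$ and all $U_1\in\Pi_{R_1}(\Sigma)$, $U_2\in\Pi_{R_2+\mathbf{v}}(\Sigma)$, there is $W\in\Sigma$ with $\Pi_{R_1}(W)=U_1$ and $\Pi_{R_2+\mathbf{v}}(W)=U_2$.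 *)

theory Defs
  imports
    "HOL-Library.FuncSet"
    "HOL-Analysis.Elementary_Metric_Spaces"
    "HOL-Analysis.Product_Vector"
    "Jordan_Normal_Form.Matrix"
begin

section \<open>Patterns\<close>

text \<open>
  The alphabet is \<open>{..<p}\<close>. A pattern on \<open>R\<close> is an extensional function, so that two patterns on
  \<open>R\<close> are equal as soon as they agree on \<open>R\<close>; for \<open>R = UNIV\<close> extensionality is void.
\<close>

definition patterns :: "nat \<Rightarrow> (int \<times> int) set \<Rightarrow> (int \<times> int \<Rightarrow> nat) set" where
  "patterns p R = R \<rightarrow>\<^sub>E {..<p}"

definition rect :: "nat \<Rightarrow> nat \<Rightarrow> int \<times> int \<Rightarrow> (int \<times> int) set" where
  "rect m n v = {(fst v + int a, snd v + int b) | a b. a < m \<and> b < n}"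

definition admissible ::
  "(int \<times> int \<Rightarrow> nat) set \<Rightarrow> (int \<times> int) set \<Rightarrow> (int \<times> int \<Rightarrow> nat) \<Rightarrow> bool" where
  "admissible B R U \<longleftrightarrow>
     (\<forall>v. rect 2 2 v \<subseteq> R \<longrightarrow> restrict (\<lambda>w. U (v + w)) (rect 2 2 (0, 0)) \<in> B)"

definition shift_space :: "nat \<Rightarrow> (int \<times> int \<Rightarrow> nat) set \<Rightarrow> (int \<times> int \<Rightarrow> nat) set" where
  "shift_space p B = {U \<in> patterns p UNIV. admissible B UNIV U}"


section \<open>Counting function and matrices\<close>

definition psi :: "nat \<Rightarrow> nat list \<Rightarrow> nat" where
  "psi p us = 1 + (\<Sum>k=1..length us. us ! (k - 1) * p ^ (length us - k))"

text \<open>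
  \<open>unpsi p n a\<close> is the word \<open>u\<^sub>1 \<dots> u\<^sub>n\<close> over \<open>{..<p}\<close> determined by \<open>psi p [u\<^sub>1, \<dots>, u\<^sub>n] = a\<close>;
  it is meaningful for \<open>1 \<le> a \<le> p ^ n\<close>.
\<close>

definition unpsi :: "nat \<Rightarrow> nat \<Rightarrow> nat \<Rightarrow> nat list" where
  "unpsi p n a = (THE us. length us = n \<and> set us \<subseteq> {..<p} \<and> psi p us = a)"

text \<open>
  Library matrices are indexed from 0, whereas the values of \<open>psi\<close> and all indices below start
  at 1: \<open>mat_of_rel\<close> and \<open>entry\<close> convert between the two conventions.
\<close>

definition mat_of_rel :: "nat \<Rightarrow> (nat \<Rightarrow> nat \<Rightarrow> bool) \<Rightarrow> nat mat" where
  "mat_of_rel r P = mat r r (\<lambda>(i, j). if P (i + 1) (j + 1) then 1 else 0)"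

definition entry :: "nat mat \<Rightarrow> nat \<Rightarrow> nat \<Rightarrow> nat" where
  "entry A i j = A $$ (i - 1, j - 1)"

text \<open>The block in position \<open>(i, j)\<close>, \<open>i, j \<ge> 1\<close>, of a matrix partitioned into blocks of size \<open>r \<times> r\<close>.\<close>

definition mat_block :: "nat \<Rightarrow> nat mat \<Rightarrow> nat \<Rightarrow> nat \<Rightarrow> nat mat" where
  "mat_block r A i j = mat r r (\<lambda>(s, t). A $$ ((i - 1) * r + s, (j - 1) * r + t))"

definition mat_block_psi :: "nat \<Rightarrow> nat \<Rightarrow> nat mat \<Rightarrow> nat \<Rightarrow> nat mat" where
  "mat_block_psi p r A \<alpha> =
     (let w = unpsi p 2 \<alpha> in mat_block r A (w ! 0 + 1) (w ! 1 + 1))"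

definition mat_list_prod :: "nat \<Rightarrow> nat mat list \<Rightarrow> nat mat" where
  "mat_list_prod r As = foldr (*) As (1\<^sub>m r)"

definition mat_set_sum :: "nat \<Rightarrow> ('k \<Rightarrow> nat mat) \<Rightarrow> 'k set \<Rightarrow> nat mat" where
  "mat_set_sum r A K = mat r r (\<lambda>ij. \<Sum>k\<in>K. A k $$ ij)"

definition non_compressible :: "nat mat \<Rightarrow> bool" where
  "non_compressible A \<longleftrightarrow>
     (\<forall>i<dim_row A. row A i \<noteq> 0\<^sub>v (dim_col A)) \<and> (\<forall>j<dim_col A. col A j \<noteq> 0\<^sub>v (dim_row A))"

text \<open>Non-negativity of the matrix is built into the entry type \<^typ>\<open>nat\<close>.\<close>

definition primitive_mat :: "nat mat \<Rightarrow> bool" where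
  "primitive_mat A \<longleftrightarrow> square_mat A \<and>
     (\<exists>N\<ge>1. \<forall>n\<ge>N. \<forall>i<dim_row A. \<forall>j<dim_col A. 0 < (A ^\<^sub>m n) $$ (i, j))"


section \<open>Transition matrices, elementary patterns and connecting operators\<close>

definition H_matrix :: "nat \<Rightarrow> (int \<times> int \<Rightarrow> nat) set \<Rightarrow> nat \<Rightarrow> nat mat" where
  "H_matrix p B n = mat_of_rel (p ^ n) (\<lambda>i j.
     \<exists>U \<in> patterns p (rect 2 n (0, 0)).
       i = psi p (map (\<lambda>t. U (0, int t)) [0..<n]) \<and>
       j = psi p (map (\<lambda>t. U (1, int t)) [0..<n]) \<and>
       admissible B (rect 2 n (0, 0)) U)"

definition V_matrix :: "nat \<Rightarrow> (int \<times> int \<Rightarrow> nat) set \<Rightarrow> nat \<Rightarrow> nat mat" where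
  "V_matrix p B n = mat_of_rel (p ^ n) (\<lambda>i j.
     \<exists>U \<in> patterns p (rect n 2 (0, 0)).
       i = psi p (map (\<lambda>s. U (int s, 0)) [0..<n]) \<and>
       j = psi p (map (\<lambda>s. U (int s, 1)) [0..<n]) \<and>
       admissible B (rect n 2 (0, 0)) U)"

definition non_degenerated :: "nat \<Rightarrow> nat mat \<Rightarrow> bool" where
  "non_degenerated p A \<longleftrightarrow> (\<forall>\<alpha>\<in>{1..p\<^sup>2}. non_compressible (mat_block_psi p p A \<alpha>))"

text \<open>
  \<open>A\<^bsub>j\<^sub>1,j\<^sub>2\<^esub> A\<^bsub>j\<^sub>2,j\<^sub>3\<^esub> \<cdots> A\<^bsub>j\<^sub>m,j\<^sub>m\<^sub>+\<^sub>1\<^esub>\<close> for the \<open>r \<times> r\<close> blocks of \<open>A\<close>, where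
  \<open>\<alpha> = psi p [j\<^sub>1 - 1, j\<^sub>m\<^sub>+\<^sub>1 - 1]\<close> and \<open>k = psi p [j\<^sub>2 - 1, \<dots>, j\<^sub>m - 1]\<close>.
\<close>

definition elementary :: "nat \<Rightarrow> nat \<Rightarrow> nat mat \<Rightarrow> nat \<Rightarrow> nat \<Rightarrow> nat \<Rightarrow> nat mat" where
  "elementary p r A m \<alpha> k =
     (let w = unpsi p 2 \<alpha>;
          js = map Suc (w ! 0 # unpsi p (m - 1) k @ [w ! 1])
      in mat_list_prod r (map (\<lambda>i. mat_block r A (js ! i) (js ! (i + 1))) [0..<m]))"

definition H_elementary ::
  "nat \<Rightarrow> (int \<times> int \<Rightarrow> nat) set \<Rightarrow> nat \<Rightarrow> nat \<Rightarrow> nat \<Rightarrow> nat \<Rightarrow> nat mat" where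
  "H_elementary p B m n \<alpha> k = elementary p (p ^ (n - 1)) (H_matrix p B n) m \<alpha> k"

definition V_elementary ::
  "nat \<Rightarrow> (int \<times> int \<Rightarrow> nat) set \<Rightarrow> nat \<Rightarrow> nat \<Rightarrow> nat \<Rightarrow> nat \<Rightarrow> nat mat" where
  "V_elementary p B m n \<alpha> k = elementary p (p ^ (n - 1)) (V_matrix p B n) m \<alpha> k"

definition S_conn ::
  "nat \<Rightarrow> (int \<times> int \<Rightarrow> nat) set \<Rightarrow> nat \<Rightarrow> nat \<Rightarrow> nat \<Rightarrow> nat mat" where
  "S_conn p B m \<alpha> \<beta> = mat_of_rel (p ^ (m - 1)) (\<lambda>s t.
     \<exists>U \<in> patterns p (rect (m + 1) 2 (0, 0)).
       \<alpha> = psi p [U (0, 0), U (int m, 0)] \<and>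
       \<beta> = psi p [U (0, 1), U (int m, 1)] \<and>
       s = psi p (map (\<lambda>a. U (int a, 0)) [1..<m]) \<and>
       t = psi p (map (\<lambda>a. U (int a, 1)) [1..<m]) \<and>
       admissible B (rect (m + 1) 2 (0, 0)) U)"

definition W_conn ::
  "nat \<Rightarrow> (int \<times> int \<Rightarrow> nat) set \<Rightarrow> nat \<Rightarrow> nat \<Rightarrow> nat \<Rightarrow> nat mat" where
  "W_conn p B m \<alpha> \<beta> = mat_of_rel (p ^ (m - 1)) (\<lambda>s t.
     \<exists>U \<in> patterns p (rect 2 (m + 1) (0, 0)).
       \<alpha> = psi p [U (0, 0), U (0, int m)] \<and>
       \<beta> = psi p [U (1, 0), U (1, int m)] \<and>
       s = psi p (map (\<lambda>b. U (0, int b)) [1..<m]) \<and>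
       t = psi p (map (\<lambda>b. U (1, int b)) [1..<m]) \<and>
       admissible B (rect 2 (m + 1) (0, 0)) U)"


section \<open>Invariant diagonal cycles\<close>

definition diag_indices :: "nat \<Rightarrow> nat set" where
  "diag_indices p = {1 + j * (p + 1) | j. j < p}"

text \<open>
  The cycle \<open>\<beta>\<^sub>1 \<dots> \<beta>\<^sub>q \<beta>\<^sub>1\<close> is given by the list \<open>[\<beta>\<^sub>1, \<dots>, \<beta>\<^sub>q]\<close>, so that \<open>q\<close> is its length. The
  parameter \<open>T\<close> is a family of connecting operators \<open>T m \<alpha> \<beta>\<close>.
\<close>

definition invariant_diagonal_cycle ::
  "nat \<Rightarrow> (nat \<Rightarrow> nat \<Rightarrow> nat \<Rightarrow> nat mat) \<Rightarrow> nat \<Rightarrow> nat list \<Rightarrow> nat set \<Rightarrow> bool" where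
  "invariant_diagonal_cycle p T m \<beta>s K \<longleftrightarrow>
     m \<ge> 2 \<and> length \<beta>s \<ge> 1 \<and> set \<beta>s \<subseteq> diag_indices p \<and> K \<subseteq> {1..p ^ (m - 1)} \<and>
     (\<forall>l\<in>K. (\<Sum>k\<in>K.
        entry (mat_list_prod (p ^ (m - 1))
          (map (\<lambda>i. T m (\<beta>s ! i) (\<beta>s ! ((i + 1) mod length \<beta>s))) [0..<length \<beta>s])) k l) \<ge> 1)"

definition S_invariant_diagonal_cycle ::
  "nat \<Rightarrow> (int \<times> int \<Rightarrow> nat) set \<Rightarrow> nat \<Rightarrow> nat list \<Rightarrow> nat set \<Rightarrow> bool" where
  "S_invariant_diagonal_cycle p B = invariant_diagonal_cycle p (S_conn p B)"

definition W_invariant_diagonal_cycle ::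
  "nat \<Rightarrow> (int \<times> int \<Rightarrow> nat) set \<Rightarrow> nat \<Rightarrow> nat list \<Rightarrow> nat set \<Rightarrow> bool" where
  "W_invariant_diagonal_cycle p B = invariant_diagonal_cycle p (W_conn p B)"


section \<open>Commutative cycle pairs\<close>

text \<open>
  The pair built from \<open>i\<^sub>1 \<dots> i\<^sub>q i\<^sub>1\<close> and \<open>j\<^sub>1 \<dots> j\<^sub>q\<^sub>' j\<^sub>1\<close> is given by the lists \<open>I = [i\<^sub>1, \<dots>, i\<^sub>q]\<close> and
  \<open>J = [j\<^sub>1, \<dots>, j\<^sub>q\<^sub>']\<close>, i.e. without the repeated last entry.
\<close>

definition commutative_cycle_pair :: "nat \<Rightarrow> nat list \<Rightarrow> nat list \<Rightarrow> bool" where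
  "commutative_cycle_pair p I J \<longleftrightarrow>
     length I \<ge> 1 \<and> length J \<ge> 1 \<and> set I \<subseteq> {1..p} \<and> set J \<subseteq> {1..p} \<and> hd J = hd I"

definition cycle_pair_index :: "nat \<Rightarrow> nat list \<Rightarrow> nat list \<Rightarrow> nat \<times> nat \<times> nat \<times> nat" where
  "cycle_pair_index p I J =
     (length I + length J,
      psi p [hd I - 1, hd I - 1],
      psi p (map (\<lambda>x. x - 1) (tl I @ hd I # tl J)),
      psi p (map (\<lambda>x. x - 1) (tl J @ hd I # tl I)))"

definition H_primitive_pair ::
  "nat \<Rightarrow> (int \<times> int \<Rightarrow> nat) set \<Rightarrow> nat list \<Rightarrow> nat list \<Rightarrow> bool" where
  "H_primitive_pair p B I J \<longleftrightarrow>
     (case cycle_pair_index p I J of (m, \<alpha>, K, L) \<Rightarrow>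
        primitive_mat (H_elementary p B m 2 \<alpha> K) \<and> primitive_mat (H_elementary p B m 2 \<alpha> L))"

definition V_primitive_pair ::
  "nat \<Rightarrow> (int \<times> int \<Rightarrow> nat) set \<Rightarrow> nat list \<Rightarrow> nat list \<Rightarrow> bool" where
  "V_primitive_pair p B I J \<longleftrightarrow>
     (case cycle_pair_index p I J of (m, \<alpha>, K, L) \<Rightarrow>
        primitive_mat (V_elementary p B m 2 \<alpha> K) \<and> primitive_mat (V_elementary p B m 2 \<alpha> L))"


section \<open>Topological mixing\<close>

text \<open>
  The product metric on \<^typ>\<open>real \<times> real\<close> is the Euclidean one. The library sets \<open>setdist\<close> to 0 when
  one of the sets is empty; this is harmless here, since prescribing values on the empty set is no
  condition.
\<close>

definition lattice_dist :: "(int \<times> int) set \<Rightarrow> (int \<times> int) set \<Rightarrow> real" where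
  "lattice_dist R1 R2 =
     setdist (map_prod real_of_int real_of_int ` R1) (map_prod real_of_int real_of_int ` R2)"

definition translate :: "int \<times> int \<Rightarrow> (int \<times> int) set \<Rightarrow> (int \<times> int) set" where
  "translate v R = (\<lambda>w. w + v) ` R"

definition topologically_mixing :: "(int \<times> int \<Rightarrow> nat) set \<Rightarrow> bool" where
  "topologically_mixing \<Sigma> \<longleftrightarrow>
     (\<forall>R1 R2. finite R1 \<and> finite R2 \<longrightarrow>
       (\<exists>M::real. \<forall>v. lattice_dist R1 (translate v R2) \<ge> M \<longrightarrow>
         (\<forall>U1 \<in> (\<lambda>W. restrict W R1) ` \<Sigma>. \<forall>U2 \<in> (\<lambda>W. restrict W (translate v R2)) ` \<Sigma>.
           \<exists>W\<in>\<Sigma>. restrict W R1 = U1 \<and> restrict W (translate v R2) = U2)))"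

end

theory Submission
  imports Defs
begin

text \<open>
  Read a \<open>2 \<times> 2\<close> pattern as a relation \<open>Q a b c d\<close> between its lower left, lower right, upper left and
  upper right symbol; exchanging the two axes exchanges \<open>H\<close> with \<open>V\<close> and \<open>S\<close> with \<open>W\<close>.
  Non-degeneracy says that a block with one free corner other than the lower left one can always be
  completed, so that symbols prescribed on the border of a quadrant extend to the quadrant, unless it
  opens to the lower left.

  Assume that for every height there is \<open>M\<close> such that any two columns can be joined in any number
  \<open>k \<ge> M\<close> of horizontal steps, and likewise for rows and vertical steps. Two square windows at large
  vertical distance are then joined, whatever their horizontal displacement, by keeping the lower
  configuration on a whole half plane, erecting on it a vertical band that leads to the upper
  configuration, and filling the two remaining quadrants.

  To join columns of arbitrary height, an invariant diagonal cycle is used from the top down: its loops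
  carry over from each level to the one \<open>q\<close> rows below, and primitivity at \<open>n = q + 1\<close> joins \<open>q\<close> further
  rows at a time. A commutative cycle pair is used from the bottom up: above \<open>(I J)\<^sup>\<infinity>\<close> one may put \<open>(J I)\<^sup>\<infinity>\<close>,
  which is the same word shifted, and primitivity connects it with the prescribed end symbols.
\<close>

section \<open>Joining columns\<close>

definition stack ::
  "nat \<Rightarrow> (nat \<Rightarrow> nat \<Rightarrow> nat \<Rightarrow> nat \<Rightarrow> bool) \<Rightarrow> nat \<Rightarrow> nat \<Rightarrow> nat \<Rightarrow> (nat \<Rightarrow> nat \<Rightarrow> nat) \<Rightarrow> bool" where
  "stack p Q h a b U \<longleftrightarrow>
     (\<forall>r\<le>h. \<forall>s. a \<le> s \<and> s \<le> b \<longrightarrow> U r s < p) \<and>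
     (\<forall>r<h. \<forall>s. a \<le> s \<and> s < b \<longrightarrow> Q (U r s) (U r (Suc s)) (U (Suc r) s) (U (Suc r) (Suc s)))"

definition connects :: "nat \<Rightarrow> (nat \<Rightarrow> nat \<Rightarrow> nat \<Rightarrow> nat \<Rightarrow> bool) \<Rightarrow> nat \<Rightarrow> nat \<Rightarrow> bool" where
  "connects p Q h k \<longleftrightarrow> (\<forall>x y. (\<forall>r\<le>h. x r < p \<and> y r < p) \<longrightarrow>
     (\<exists>U. stack p Q h 0 k U \<and> (\<forall>r\<le>h. U r 0 = x r \<and> U r k = y r)))"

definition uniformly_connected :: "nat \<Rightarrow> (nat \<Rightarrow> nat \<Rightarrow> nat \<Rightarrow> nat \<Rightarrow> bool) \<Rightarrow> bool" where
  "uniformly_connected p Q \<longleftrightarrow> (\<forall>h. \<exists>M. \<forall>k\<ge>M. connects p Q h k)"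

lemma stack_entry: "stack p Q h a b U \<Longrightarrow> r \<le> h \<Longrightarrow> a \<le> s \<Longrightarrow> s \<le> b \<Longrightarrow> U r s < p"
  by (simp add: stack_def)

lemma stack_block:
  "stack p Q h a b U \<Longrightarrow> r < h \<Longrightarrow> a \<le> s \<Longrightarrow> s < b \<Longrightarrow>
     Q (U r s) (U r (Suc s)) (U (Suc r) s) (U (Suc r) (Suc s))"
  by (simp add: stack_def)

lemma stack_mono: "stack p Q h a b U \<Longrightarrow> h' \<le> h \<Longrightarrow> stack p Q h' a b U"
  by (auto simp: stack_def)

lemma stack_append:
  assumes U: "stack p Q h a b U" and V: "stack p Q h b c V"
    and eq: "\<And>r. r \<le> h \<Longrightarrow> U r b = V r b"
  shows "stack p Q h a c (\<lambda>r s. if s \<le> b then U r s else V r s)"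
  unfolding stack_def
proof (intro conjI allI impI)
  fix r s assume "r \<le> h" "a \<le> s \<and> s \<le> c"
  then show "(if s \<le> b then U r s else V r s) < p"
    using stack_entry[OF U] stack_entry[OF V] by auto
next
  fix r s assume r: "r < h" and s: "a \<le> s \<and> s < c"
  consider "s < b" | "s = b" | "b < s" by linarith
  then show "Q (if s \<le> b then U r s else V r s) (if Suc s \<le> b then U r (Suc s) else V r (Suc s))
         (if s \<le> b then U (Suc r) s else V (Suc r) s)
         (if Suc s \<le> b then U (Suc r) (Suc s) else V (Suc r) (Suc s))"
  proof cases
    case 1 then show ?thesis using stack_block[OF U r] s by simp
  next
    case 2 then show ?thesis using stack_block[OF V r, of s] s eq r by simp
  next
    case 3 then show ?thesis using stack_block[OF V r, of s] s by simp
  qed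
qed

lemma stack_above:
  assumes U: "stack p Q g a b U" and V: "stack p Q h a b V"
    and eq: "\<And>s. a \<le> s \<Longrightarrow> s \<le> b \<Longrightarrow> U g s = V 0 s"
  shows "stack p Q (g + h) a b (\<lambda>r s. if r \<le> g then U r s else V (r - g) s)"
  unfolding stack_def
proof (intro conjI allI impI)
  fix r s assume "r \<le> g + h" "a \<le> s \<and> s \<le> b"
  then show "(if r \<le> g then U r s else V (r - g) s) < p"
    using stack_entry[OF U] stack_entry[OF V] by auto
next
  fix r s assume r: "r < g + h" and s: "a \<le> s \<and> s < b"
  consider "r < g" | "r = g" | "g < r" by linarith
  then show "Q (if r \<le> g then U r s else V (r - g) s) (if r \<le> g then U r (Suc s) else V (r - g) (Suc s))
         (if Suc r \<le> g then U (Suc r) s else V (Suc r - g) s)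
         (if Suc r \<le> g then U (Suc r) (Suc s) else V (Suc r - g) (Suc s))"
  proof cases
    case 1 then show ?thesis using stack_block[OF U] s by simp
  next
    case 2 then show ?thesis using stack_block[OF V, of 0 s] s eq r by simp
  next
    case 3 then show ?thesis using stack_block[OF V, of "r - g" s] s r by (simp add: Suc_diff_le)
  qed
qed

lemma stack_shift:
  assumes U: "stack p Q h a b U" and c: "c = a + d" "e = b + d"
  shows "stack p Q h c e (\<lambda>r s. U r (s - d))"
  unfolding stack_def
proof (intro conjI allI impI)
  fix r s assume "r \<le> h" "c \<le> s \<and> s \<le> e"
  then show "U r (s - d) < p"
    using c by (intro stack_entry[OF U]) auto
next
  fix r s assume r: "r < h" and s: "c \<le> s \<and> s < e"
  have "a \<le> s - d" "s - d < b" "Suc s - d = Suc (s - d)" using s c by auto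
  then show "Q (U r (s - d)) (U r (Suc s - d)) (U (Suc r) (s - d)) (U (Suc r) (Suc s - d))"
    using stack_block[OF U r, of "s - d"] by simp
qed

fun quadrant ::
  "(nat \<Rightarrow> nat \<Rightarrow> nat \<Rightarrow> nat) \<Rightarrow> (nat \<Rightarrow> nat) \<Rightarrow> (nat \<Rightarrow> nat) \<Rightarrow> nat \<Rightarrow> nat \<Rightarrow> nat" where
  "quadrant e f x i 0 = f i"
| "quadrant e f x 0 (Suc j) = x (Suc j)"
| "quadrant e f x (Suc i) (Suc j) =
     e (quadrant e f x i j) (quadrant e f x (Suc i) j) (quadrant e f x i (Suc j))"

lemma quadrant_extension:
  assumes R: "\<And>a b c. a < p \<Longrightarrow> b < p \<Longrightarrow> c < p \<Longrightarrow> \<exists>d<p. R a b c (d::nat)"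
    and f: "\<And>i. f i < p" and x: "\<And>j. x j < p" and eq: "f 0 = x 0"
  shows "\<exists>G. (\<forall>i. G i 0 = f i) \<and> (\<forall>j. G 0 j = x j) \<and> (\<forall>i j. G i j < p) \<and>
     (\<forall>i j. R (G i j) (G (Suc i) j) (G i (Suc j)) (G (Suc i) (Suc j)))"
proof -
  define e where "e a b c = (SOME d. d < p \<and> R a b c d)" for a b c
  have e: "e a b c < p \<and> R a b c (e a b c)" if "a < p" "b < p" "c < p" for a b c
    unfolding e_def using R[OF that] by (rule someI_ex[OF exE]) blast
  let ?G = "quadrant e f x"
  have lt: "?G i j < p" for i j
  proof (induction i arbitrary: j)
    case 0 then show ?case using f x by (cases j) auto
  next
    case (Suc i)
    show ?case by (induction j) (use f e Suc in auto)
  qed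
  have "?G 0 j = x j" for j using eq by (cases j) auto
  moreover have "R (?G i j) (?G (Suc i) j) (?G i (Suc j)) (?G (Suc i) (Suc j))" for i j
    using e lt by simp
  ultimately show ?thesis using lt by (intro exI[of _ ?G]) auto
qed

lemma stack_join:
  assumes U: "stack p Q h 0 a U" and V: "stack p Q h 0 b V"
    and eq: "\<And>r. r \<le> h \<Longrightarrow> U r a = V r 0"
  obtains W where "stack p Q h 0 (a + b) W"
    "\<And>r s. r \<le> h \<Longrightarrow> s \<le> a \<Longrightarrow> W r s = U r s"
    "\<And>r s. r \<le> h \<Longrightarrow> s \<le> b \<Longrightarrow> W r (a + s) = V r s"
proof -
  let ?W = "\<lambda>r s. if s \<le> a then U r s else V r (s - a)"
  have "stack p Q h 0 (a + b) ?W"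
    by (rule stack_append[OF U stack_shift[OF V]]) (use eq in auto)
  moreover have "?W r (a + s) = V r s" if "r \<le> h" for r s
    using eq[OF that] by (cases s) auto
  ultimately show thesis using that[of ?W] by simp
qed

lemma stack_pile:
  assumes U: "stack p Q g a b U" and V: "stack p Q h a b V"
    and eq: "\<And>s. a \<le> s \<Longrightarrow> s \<le> b \<Longrightarrow> U g s = V 0 s"
  obtains W where "stack p Q (g + h) a b W"
    "\<And>r s. r \<le> g \<Longrightarrow> W r s = U r s"
    "\<And>r s. r \<le> h \<Longrightarrow> a \<le> s \<Longrightarrow> s \<le> b \<Longrightarrow> W (g + r) s = V r s"
proof -
  let ?W = "\<lambda>r s. if r \<le> g then U r s else V (r - g) s"
  have "?W (g + r) s = V r s" if "a \<le> s" "s \<le> b" for r s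
    using eq[OF that] by (cases r) auto
  then show thesis using that[of ?W] stack_above[OF U V eq] by auto
qed

lemma stack_tile:
  assumes R: "\<And>j. j < N \<Longrightarrow> stack p Q h 0 m (R j)"
    and c: "\<And>j i. j < N \<Longrightarrow> i \<le> h \<Longrightarrow> R j i 0 = c j i \<and> R j i m = c (Suc j) i"
    and c0: "\<And>i. i \<le> h \<Longrightarrow> c 0 i < p"
  shows "\<exists>M. stack p Q h 0 (N * m) M \<and> (\<forall>i\<le>h. M i 0 = c 0 i \<and> M i (N * m) = c N i) \<and>
     (\<forall>j<N. \<forall>i\<le>h. \<forall>s\<le>m. M i (j * m + s) = R j i s)"
  using R c
proof (induction N)
  case 0
  have "stack p Q h 0 0 (\<lambda>i s. c 0 i)" using c0 by (simp add: stack_def)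
  then show ?case by (intro exI[of _ "\<lambda>i s. c 0 i"]) auto
next
  case (Suc N)
  have "\<exists>M. stack p Q h 0 (N * m) M \<and> (\<forall>i\<le>h. M i 0 = c 0 i \<and> M i (N * m) = c N i) \<and>
     (\<forall>j<N. \<forall>i\<le>h. \<forall>s\<le>m. M i (j * m + s) = R j i s)"
    using Suc.prems by (intro Suc.IH) simp_all
  then obtain M where M: "stack p Q h 0 (N * m) M" "\<forall>i\<le>h. M i 0 = c 0 i \<and> M i (N * m) = c N i"
      "\<forall>j<N. \<forall>i\<le>h. \<forall>s\<le>m. M i (j * m + s) = R j i s"
    by blast
  obtain W where W: "stack p Q h 0 (N * m + m) W"
      "\<And>r s. r \<le> h \<Longrightarrow> s \<le> N * m \<Longrightarrow> W r s = M r s"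
      "\<And>r s. r \<le> h \<Longrightarrow> s \<le> m \<Longrightarrow> W r (N * m + s) = R N r s"
    by (rule stack_join[OF M(1) Suc.prems(1)[of N]]) (use M(2) Suc.prems(2) in auto)
  have "W i (j * m + s) = R j i s" if "j < Suc N" "i \<le> h" "s \<le> m" for j i s
  proof (cases "j = N")
    case True then show ?thesis using W(3) that by simp
  next
    case False
    then have j: "j < N" using that by simp
    have "j * m + s \<le> N * m" using mult_le_mono1[of "Suc j" N m] j that by simp
    then show ?thesis using W(2) M(3) j that by simp
  qed
  moreover have "W i 0 = c 0 i" "W i (Suc N * m) = c (Suc N) i" if "i \<le> h" for i
    using W(2)[OF that, of 0] W(3)[OF that, of m] M(2) Suc.prems(2)[of N i] that
    by (simp_all add: add.commute)
  ultimately show ?case using W(1) by (intro exI[of _ W]) (simp add: add.commute)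
qed

definition loop_run ::
  "nat \<Rightarrow> (nat \<Rightarrow> nat \<Rightarrow> nat \<Rightarrow> nat \<Rightarrow> bool) \<Rightarrow> nat list set \<Rightarrow> nat \<Rightarrow> nat \<Rightarrow> nat \<Rightarrow>
     (nat \<Rightarrow> nat) \<Rightarrow> (nat \<Rightarrow> nat) \<Rightarrow> (nat \<Rightarrow> nat \<Rightarrow> nat) \<Rightarrow> bool" where
  "loop_run p Q L m h N x y U \<longleftrightarrow> stack p Q h 0 (N * m) U \<and>
     (\<forall>r\<le>h. U r 0 = x r \<and> U r (N * m) = y r) \<and>
     (\<forall>j<N. \<exists>w\<in>L. \<forall>s\<le>m. U 0 (j * m + s) = w ! s)"

definition loop_connected ::
  "nat \<Rightarrow> (nat \<Rightarrow> nat \<Rightarrow> nat \<Rightarrow> nat \<Rightarrow> bool) \<Rightarrow> nat list set \<Rightarrow> nat \<Rightarrow> nat \<Rightarrow> nat \<Rightarrow> bool" where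
  "loop_connected p Q L m b h \<longleftrightarrow> (\<exists>N0. \<forall>N\<ge>N0. \<forall>x y.
     (\<forall>r\<le>h. x r < p \<and> y r < p) \<and> x 0 = b \<and> y 0 = b \<longrightarrow> (\<exists>U. loop_run p Q L m h N x y U))"

lemma loop_connectedE:
  assumes "loop_connected p Q L m b h"
  obtains N0 where "\<And>N x y. N0 \<le> N \<Longrightarrow> (\<And>r. r \<le> h \<Longrightarrow> x r < p) \<Longrightarrow> (\<And>r. r \<le> h \<Longrightarrow> y r < p) \<Longrightarrow>
    x 0 = b \<Longrightarrow> y 0 = b \<Longrightarrow> \<exists>U. loop_run p Q L m h N x y U"
  using assms unfolding loop_connected_def by blast

locale fillable =
  fixes p :: nat and Q :: "nat \<Rightarrow> nat \<Rightarrow> nat \<Rightarrow> nat \<Rightarrow> bool"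
  assumes p_pos: "0 < p"
    and fill_right: "a < p \<Longrightarrow> b < p \<Longrightarrow> c < p \<Longrightarrow> \<exists>d<p. Q a b c d"
    and fill_left: "a < p \<Longrightarrow> b < p \<Longrightarrow> d < p \<Longrightarrow> \<exists>c<p. Q a b c d"
begin

lemma extend_right:
  assumes f: "\<And>s. a \<le> s \<Longrightarrow> s \<le> b \<Longrightarrow> f s < p" and x: "\<And>r. r \<le> h \<Longrightarrow> x r < p"
    and eq: "x 0 = f a" and ab: "a \<le> b"
  shows "\<exists>U. stack p Q h a b U \<and> (\<forall>s. a \<le> s \<longrightarrow> s \<le> b \<longrightarrow> U 0 s = f s) \<and> (\<forall>r\<le>h. U r a = x r)"
proof -
  obtain G where G: "\<forall>i. G i 0 = f (min (a + i) b)" "\<forall>j. G 0 j = x (min j h)" "\<forall>i j. G i j < p"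
     "\<forall>i j. Q (G i j) (G (Suc i) j) (G i (Suc j)) (G (Suc i) (Suc j))"
    using quadrant_extension[of p Q "\<lambda>i. f (min (a + i) b)" "\<lambda>j. x (min j h)"] fill_right f x eq ab
    by auto
  have "stack p Q h a b (\<lambda>r s. G (s - a) r)"
    unfolding stack_def using G(3) G(4)[rule_format, of "s - a" r for s r] by (auto simp: Suc_diff_le)
  then show ?thesis using G by (intro exI[of _ "\<lambda>r s. G (s - a) r"]) auto
qed

lemma extend_left:
  assumes f: "\<And>s. a \<le> s \<Longrightarrow> s \<le> b \<Longrightarrow> f s < p" and x: "\<And>r. r \<le> h \<Longrightarrow> x r < p"
    and eq: "x 0 = f b" and ab: "a \<le> b"
  shows "\<exists>U. stack p Q h a b U \<and> (\<forall>s. a \<le> s \<longrightarrow> s \<le> b \<longrightarrow> U 0 s = f s) \<and> (\<forall>r\<le>h. U r b = x r)"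
proof -
  obtain G where G: "\<forall>i. G i 0 = f (max (b - i) a)" "\<forall>j. G 0 j = x (min j h)" "\<forall>i j. G i j < p"
     "\<forall>i j. Q (G (Suc i) j) (G i j) (G (Suc i) (Suc j)) (G i (Suc j))"
    using quadrant_extension[of p "\<lambda>a b c d. Q b a d c" "\<lambda>i. f (max (b - i) a)" "\<lambda>j. x (min j h)"]
      fill_left f x eq ab by (auto simp: max_def)
  have "stack p Q h a b (\<lambda>r s. G (b - s) r)"
    unfolding stack_def using G(3) G(4)[rule_format, of "b - Suc s" r for s r]
    by auto (metis Suc_diff_Suc)
  then show ?thesis using G by (intro exI[of _ "\<lambda>r s. G (b - s) r"]) (auto simp: max_def)
qed


lemma connects_of_loop_connected:
  assumes L: "loop_connected p Q L m b h" and b: "b < p"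
  shows "\<exists>M. \<forall>k\<ge>M. connects p Q h k"
proof -
  obtain N where N: "\<And>N' x y. N \<le> N' \<Longrightarrow> (\<And>r. r \<le> h \<Longrightarrow> x r < p) \<Longrightarrow> (\<And>r. r \<le> h \<Longrightarrow> y r < p) \<Longrightarrow>
      x 0 = b \<Longrightarrow> y 0 = b \<Longrightarrow> \<exists>U. loop_run p Q L m h N' x y U"
    using loop_connectedE[OF L] by metis
  have "connects p Q h k" if k: "k \<ge> N * m + 2" for k
    unfolding connects_def
  proof (intro allI impI)
    fix x y :: "nat \<Rightarrow> nat" assume xy: "\<forall>r\<le>h. x r < p \<and> y r < p"
    define e where "e = k - 1 - N * m"
    have e: "0 < e" "k = (1 + N * m) + e" using k by (auto simp: e_def)
    obtain U1 where U1: "stack p Q h 0 1 U1" "U1 0 1 = b" "\<forall>r\<le>h. U1 r 0 = x r"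
      using extend_right[of 0 1 "\<lambda>s. if s = 0 then x 0 else b" h x] xy b by force
    obtain U3 where U3: "stack p Q h 0 e U3" "U3 0 0 = b" "\<forall>r\<le>h. U3 r e = y r"
      using extend_left[of 0 e "\<lambda>s. if s = e then y 0 else b" h y] xy b e by force
    obtain U2 where U2: "stack p Q h 0 (N * m) U2" "\<forall>r\<le>h. U2 r 0 = U1 r 1 \<and> U2 r (N * m) = U3 r 0"
      using N[of N "\<lambda>r. U1 r 1" "\<lambda>r. U3 r 0"] U1 U3 stack_entry[OF U1(1)] stack_entry[OF U3(1)]
      by (auto simp: loop_run_def)
    obtain V where V: "stack p Q h 0 (1 + N * m) V"
        "\<And>r s. r \<le> h \<Longrightarrow> s \<le> 1 \<Longrightarrow> V r s = U1 r s"
        "\<And>r s. r \<le> h \<Longrightarrow> s \<le> N * m \<Longrightarrow> V r (1 + s) = U2 r s"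
      by (rule stack_join[OF U1(1) U2(1)]) (use U2 in auto)
    obtain W where W: "stack p Q h 0 k W"
        "\<And>r s. r \<le> h \<Longrightarrow> s \<le> 1 + N * m \<Longrightarrow> W r s = V r s"
        "\<And>r s. r \<le> h \<Longrightarrow> s \<le> e \<Longrightarrow> W r (1 + N * m + s) = U3 r s"
      by (rule stack_join[OF V(1) U3(1)]) (use U2 V(3)[of _ "N * m"] e in auto)
    have "W r 0 = x r" "W r k = y r" if "r \<le> h" for r
      using W(2)[OF that, of 0] V(2)[OF that, of 0] W(3)[OF that, of e] U1 U3 that e by auto
    then show "\<exists>U. stack p Q h 0 k U \<and> (\<forall>r\<le>h. U r 0 = x r \<and> U r k = y r)"
      using W(1) by blast
  qed
  then show ?thesis by blast
qed

text \<open>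
  Over every loop of a concatenation of loops in the middle part sits a block of height \<open>q\<close> whose top
  row is prescribed and whose bottom row is again a loop in \<open>L\<close>; the two outer parts connect the
  prescribed columns with the border columns of these blocks.
\<close>

lemma loop_connected_add:
  assumes Lq: "loop_connected p Q L m b q" and Lh: "loop_connected p Q L m b h"
    and m: "0 < m" and bs: "\<And>i. i \<le> q \<Longrightarrow> bs i < p" "bs 0 = b" "bs q = b"
    and R: "\<And>w. w \<in> L \<Longrightarrow> \<exists>R. stack p Q q 0 m R \<and> (\<forall>i\<le>q. R i 0 = bs i \<and> R i m = bs i) \<and>
      (\<forall>s\<le>m. R q s = w ! s) \<and> (\<exists>w'\<in>L. \<forall>s\<le>m. R 0 s = w' ! s)"
  shows "loop_connected p Q L m b (q + h)"
proof -
  obtain Nq where Nq: "\<And>N x y. Nq \<le> N \<Longrightarrow> (\<And>r. r \<le> q \<Longrightarrow> x r < p) \<Longrightarrow> (\<And>r. r \<le> q \<Longrightarrow> y r < p) \<Longrightarrow>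
      x 0 = b \<Longrightarrow> y 0 = b \<Longrightarrow> \<exists>U. loop_run p Q L m q N x y U"
    using loop_connectedE[OF Lq] by metis
  obtain Nh where Nh: "\<And>N x y. Nh \<le> N \<Longrightarrow> (\<And>r. r \<le> h \<Longrightarrow> x r < p) \<Longrightarrow> (\<And>r. r \<le> h \<Longrightarrow> y r < p) \<Longrightarrow>
      x 0 = b \<Longrightarrow> y 0 = b \<Longrightarrow> \<exists>U. loop_run p Q L m h N x y U"
    using loop_connectedE[OF Lh] by metis
  have "\<exists>U. loop_run p Q L m (q + h) N x y U"
    if N: "N \<ge> Nq + Nh + Nq" and xy: "\<forall>r\<le>q + h. x r < p \<and> y r < p" "x 0 = b" "y 0 = b" for N x y
  proof -
    define N' where "N' = N - Nq - Nq"
    have N': "N = Nq + N' + Nq" "Nh \<le> N'" using N by (auto simp: N'_def)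
    define A B where "A = Nq * m" and "B = N' * m"
    obtain U1 where "loop_run p Q L m q Nq x bs U1" using Nq[of Nq x bs] xy bs by auto
    then have U1: "stack p Q q 0 A U1" "\<forall>r\<le>q. U1 r 0 = x r \<and> U1 r A = bs r"
        "\<forall>j<Nq. \<exists>w\<in>L. \<forall>s\<le>m. U1 0 (j * m + s) = w ! s" by (auto simp: A_def loop_run_def)
    obtain U3 where "loop_run p Q L m q Nq bs y U3" using Nq[of Nq bs y] xy bs by auto
    then have U3: "stack p Q q 0 A U3" "\<forall>r\<le>q. U3 r 0 = bs r \<and> U3 r A = y r"
        "\<forall>j<Nq. \<exists>w\<in>L. \<forall>s\<le>m. U3 0 (j * m + s) = w ! s" by (auto simp: A_def loop_run_def)
    obtain V1 where V1: "stack p Q h 0 A V1" "\<forall>s. 0 \<le> s \<longrightarrow> s \<le> A \<longrightarrow> V1 0 s = U1 q s"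
        "\<forall>r\<le>h. V1 r 0 = x (q + r)"
      using extend_right[of 0 A "U1 q" h "\<lambda>r. x (q + r)"] stack_entry[OF U1(1), of q] U1(2) xy by auto
    obtain V3 where V3: "stack p Q h 0 A V3" "\<forall>s. 0 \<le> s \<longrightarrow> s \<le> A \<longrightarrow> V3 0 s = U3 q s"
        "\<forall>r\<le>h. V3 r A = y (q + r)"
      using extend_left[of 0 A "U3 q" h "\<lambda>r. y (q + r)"] stack_entry[OF U3(1), of q] U3(2) xy by auto
    have "\<exists>U. loop_run p Q L m h N' (\<lambda>r. V1 r A) (\<lambda>r. V3 r 0) U"
      using N' stack_entry[OF V1(1)] stack_entry[OF V3(1)] V1(2) V3(2) U1(2) U3(2) bs
      by (intro Nh) auto
    then obtain U2 where U2: "stack p Q h 0 B U2" "\<forall>r\<le>h. U2 r 0 = V1 r A \<and> U2 r B = V3 r 0"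
        "\<forall>j<N'. \<exists>w\<in>L. \<forall>s\<le>m. U2 0 (j * m + s) = w ! s" by (auto simp: B_def loop_run_def)
    have "\<forall>j. \<exists>R. j < N' \<longrightarrow> stack p Q q 0 m R \<and> (\<forall>i\<le>q. R i 0 = bs i \<and> R i m = bs i) \<and>
      (\<forall>s\<le>m. R q s = U2 0 (j * m + s)) \<and> (\<exists>w'\<in>L. \<forall>s\<le>m. R 0 s = w' ! s)"
    proof
      fix j
      show "\<exists>R. j < N' \<longrightarrow> stack p Q q 0 m R \<and> (\<forall>i\<le>q. R i 0 = bs i \<and> R i m = bs i) \<and>
        (\<forall>s\<le>m. R q s = U2 0 (j * m + s)) \<and> (\<exists>w'\<in>L. \<forall>s\<le>m. R 0 s = w' ! s)"
      proof (cases "j < N'")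
        case True
        then obtain w where "w \<in> L" "\<forall>s\<le>m. U2 0 (j * m + s) = w ! s" using U2(3) by blast
        then show ?thesis using R[of w] by auto
      qed auto
    qed
    from choice[OF this] obtain T where
      T': "\<And>j. j < N' \<longrightarrow> stack p Q q 0 m (T j) \<and> (\<forall>i\<le>q. T j i 0 = bs i \<and> T j i m = bs i) \<and>
        (\<forall>s\<le>m. T j q s = U2 0 (j * m + s)) \<and> (\<exists>w'\<in>L. \<forall>s\<le>m. T j 0 s = w' ! s)" by blast
    then have T: "\<And>j. j < N' \<Longrightarrow> stack p Q q 0 m (T j)"
        "\<And>j i. j < N' \<Longrightarrow> i \<le> q \<Longrightarrow> T j i 0 = bs i \<and> T j i m = bs i"
        "\<And>j s. j < N' \<Longrightarrow> s \<le> m \<Longrightarrow> T j q s = U2 0 (j * m + s)"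
        "\<And>j. j < N' \<Longrightarrow> \<exists>w'\<in>L. \<forall>s\<le>m. T j 0 s = w' ! s" by simp_all
    obtain M where M: "stack p Q q 0 B M" "\<forall>i\<le>q. M i 0 = bs i \<and> M i B = bs i"
        "\<forall>j<N'. \<forall>i\<le>q. \<forall>s\<le>m. M i (j * m + s) = T j i s"
      using stack_tile[of N' p Q q m T "\<lambda>_. bs"] T(1,2) bs(1) unfolding B_def by auto
    have Mq: "M q s = U2 0 s" if "s \<le> B" for s
    proof (cases "s = B")
      case True then show ?thesis using M(2) U2(2) V3(2) U3(2) by simp
    next
      case False
      then have "s div m < N'" using that m by (simp add: B_def less_mult_imp_div_less)
      moreover have "s mod m \<le> m" using m by (simp add: less_imp_le)
      ultimately show ?thesis
        using M(3)[rule_format, of "s div m" q "s mod m"] T(3)[of "s div m" "s mod m"] by simp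
    qed
    obtain X1 where X1: "stack p Q (q + h) 0 A X1" "\<And>r s. r \<le> q \<Longrightarrow> X1 r s = U1 r s"
        "\<And>r s. r \<le> h \<Longrightarrow> 0 \<le> s \<Longrightarrow> s \<le> A \<Longrightarrow> X1 (q + r) s = V1 r s"
      using stack_pile[OF U1(1) V1(1)] V1(2) by auto
    obtain X2 where X2: "stack p Q (q + h) 0 B X2" "\<And>r s. r \<le> q \<Longrightarrow> X2 r s = M r s"
        "\<And>r s. r \<le> h \<Longrightarrow> 0 \<le> s \<Longrightarrow> s \<le> B \<Longrightarrow> X2 (q + r) s = U2 r s"
      using stack_pile[OF M(1) U2(1)] Mq by auto
    obtain X3 where X3: "stack p Q (q + h) 0 A X3" "\<And>r s. r \<le> q \<Longrightarrow> X3 r s = U3 r s"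
        "\<And>r s. r \<le> h \<Longrightarrow> 0 \<le> s \<Longrightarrow> s \<le> A \<Longrightarrow> X3 (q + r) s = V3 r s"
      using stack_pile[OF U3(1) V3(1)] V3(2) by auto
    have row: "r \<le> q \<or> (\<exists>r'\<le>h. r = q + r')" if "r \<le> q + h" for r
      using that by presburger
    have j12: "X1 r A = X2 r 0" and j23: "X2 r B = X3 r 0"
      and bx: "X1 r 0 = x r" and by': "X3 r A = y r" if "r \<le> q + h" for r
      using row[OF that] U1(2) U3(2) M(2) X1(2,3) X2(2,3) X3(2,3) U2(2) V1(3) V3(3) by auto
    obtain Y where Y: "stack p Q (q + h) 0 (A + B) Y"
        "\<And>r s. r \<le> q + h \<Longrightarrow> s \<le> A \<Longrightarrow> Y r s = X1 r s"
        "\<And>r s. r \<le> q + h \<Longrightarrow> s \<le> B \<Longrightarrow> Y r (A + s) = X2 r s"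
      using stack_join[OF X1(1) X2(1)] j12 by metis
    obtain Z where Z: "stack p Q (q + h) 0 (A + B + A) Z"
        "\<And>r s. r \<le> q + h \<Longrightarrow> s \<le> A + B \<Longrightarrow> Z r s = Y r s"
        "\<And>r s. r \<le> q + h \<Longrightarrow> s \<le> A \<Longrightarrow> Z r (A + B + s) = X3 r s"
      using stack_join[OF Y(1) X3(1)] j23 Y(3) by (metis order_refl)
    have len: "A + B + A = N * m" by (simp add: A_def B_def N' algebra_simps)
    have "\<exists>w\<in>L. \<forall>s\<le>m. Z 0 (j * m + s) = w ! s" if "j < N" for j
    proof -
      consider "j < Nq" | j' where "j = Nq + j'" "j' < N'" | j' where "j = Nq + N' + j'" "j' < Nq"
        using \<open>j < N\<close> N'(1) by (metis add.assoc add_less_cancel_left le_add_diff_inverse not_less)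
      then show ?thesis
      proof cases
        case 1
        have "Z 0 (j * m + s) = U1 0 (j * m + s)" if "s \<le> m" for s
        proof -
          have "j * m + s \<le> A" using mult_le_mono1[of "Suc j" Nq m] 1 that by (simp add: A_def)
          then show ?thesis using Z(2) Y(2) X1(2) by simp
        qed
        then show ?thesis using U1(3) 1 by simp
      next
        case 2
        have "Z 0 (j * m + s) = T j' 0 s" if "s \<le> m" for s
        proof -
          have "j' * m + s \<le> B" using mult_le_mono1[of "Suc j'" N' m] 2 that by (simp add: B_def)
          moreover have "j * m + s = A + (j' * m + s)" by (simp add: 2 A_def algebra_simps)
          ultimately have "Z 0 (j * m + s) = X2 0 (j' * m + s)"
            using Z(2)[of 0 "A + (j' * m + s)"] Y(3)[of 0 "j' * m + s"] by (simp add: add.assoc)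
          then show ?thesis using X2(2) M(3) 2(2) that by simp
        qed
        then show ?thesis using T(4) 2 by simp
      next
        case 3
        have "Z 0 (j * m + s) = U3 0 (j' * m + s)" if "s \<le> m" for s
        proof -
          have "j' * m + s \<le> A" using mult_le_mono1[of "Suc j'" Nq m] 3 that by (simp add: A_def)
          moreover have "j * m + s = A + B + (j' * m + s)" by (simp add: 3 A_def B_def algebra_simps)
          ultimately show ?thesis using Z(3) X3(2) by (simp add: add.assoc)
        qed
        then show ?thesis using U3(3) 3 by simp
      qed
    qed
    moreover have "Z r 0 = x r \<and> Z r (N * m) = y r" if "r \<le> q + h" for r
      using Z(2,3)[OF that] Y(2)[OF that, of 0] bx by' that by (auto simp flip: len)
    ultimately show ?thesis using Z(1) len unfolding loop_run_def by auto
  qed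
  then show ?thesis unfolding loop_connected_def by blast
qed

lemma loop_connected_mono:
  assumes L: "loop_connected p Q L m b h" and h: "h' \<le> h"
  shows "loop_connected p Q L m b h'"
proof -
  obtain N0 where N0: "\<And>N x y. N0 \<le> N \<Longrightarrow> (\<And>r. r \<le> h \<Longrightarrow> x r < p) \<Longrightarrow> (\<And>r. r \<le> h \<Longrightarrow> y r < p) \<Longrightarrow>
      x 0 = b \<Longrightarrow> y 0 = b \<Longrightarrow> \<exists>U. loop_run p Q L m h N x y U"
    using loop_connectedE[OF L] by metis
  have "\<exists>U. loop_run p Q L m h' N x y U"
    if "N \<ge> N0" "\<forall>r\<le>h'. x r < p \<and> y r < p" "x 0 = b" "y 0 = b" for N x y
  proof -
    have "\<exists>U. loop_run p Q L m h N (\<lambda>r. x (min r h')) (\<lambda>r. y (min r h')) U"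
      using that by (intro N0) auto
    then obtain U where U: "loop_run p Q L m h N (\<lambda>r. x (min r h')) (\<lambda>r. y (min r h')) U" by blast
    have "loop_run p Q L m h' N x y U"
      using U h stack_mono[of p Q h 0 "N * m" U h'] unfolding loop_run_def by auto
    then show ?thesis by blast
  qed
  then show ?thesis unfolding loop_connected_def by blast
qed

lemma uniformly_connected_of_loops:
  assumes Lq: "loop_connected p Q L m b q" and q: "0 < q"
    and m: "0 < m" and bs: "\<And>i. i \<le> q \<Longrightarrow> bs i < p" "bs 0 = b" "bs q = b"
    and R: "\<And>w. w \<in> L \<Longrightarrow> \<exists>R. stack p Q q 0 m R \<and> (\<forall>i\<le>q. R i 0 = bs i \<and> R i m = bs i) \<and>
      (\<forall>s\<le>m. R q s = w ! s) \<and> (\<exists>w'\<in>L. \<forall>s\<le>m. R 0 s = w' ! s)"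
  shows "uniformly_connected p Q"
proof -
  have "loop_connected p Q L m b (c * q)" for c
  proof (induction c)
    case 0 then show ?case using loop_connected_mono[OF Lq] by simp
  next
    case (Suc c)
    then show ?case using loop_connected_add[OF Lq Suc m bs R] by simp
  qed
  then have "loop_connected p Q L m b h" for h
    using loop_connected_mono[of L m b "h * q" h] q by simp
  moreover have "b < p" using bs(1)[of 0] bs(2) by simp
  ultimately show ?thesis
    unfolding uniformly_connected_def using connects_of_loop_connected by blast
qed


text \<open>
  Every row is extended so that it contains a long stretch of the periodic word \<open>P\<close>. Over such a
  stretch the next row runs from its value at the left end to the shifted word, follows it, and runs to
  its value at the right end; the shifted word contains again a long stretch of \<open>P\<close>.
\<close>

lemma uniformly_connected_of_shift:
  fixes P :: "nat \<Rightarrow> nat"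
  assumes L: "loop_connected p Q {map P [0..<Suc m]} m (P 0) 1" and m: "0 < m"
    and P: "\<And>s. P s < p" "\<And>s. P (s + m) = P s" and d: "d \<le> m" "P d = P 0"
    and Q: "\<And>s. Q (P s) (P (Suc s)) (P (s + d)) (P (Suc s + d))"
  shows "uniformly_connected p Q"
proof -
  obtain N where N: "\<And>N' x y. N \<le> N' \<Longrightarrow> (\<And>r. r \<le> 1 \<Longrightarrow> x r < p) \<Longrightarrow> (\<And>r. r \<le> 1 \<Longrightarrow> y r < p) \<Longrightarrow>
      x 0 = P 0 \<Longrightarrow> y 0 = P 0 \<Longrightarrow> \<exists>U. loop_run p Q {map P [0..<Suc m]} m 1 N' x y U"
    using loop_connectedE[OF L] by metis
  define A where "A = N * m"
  have per: "P (s + j * m) = P s" for s j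
  proof (induction j)
    case (Suc j)
    then show ?case using P(2)[of "s + j * m"] by (simp add: ac_simps)
  qed simp
  have run: "\<exists>V. stack p Q 1 0 A V \<and> (\<forall>s\<le>A. V 0 s = P s) \<and> V 1 0 = c \<and> V 1 A = e"
    if "c < p" "e < p" for c e
  proof -
    have "\<exists>U. loop_run p Q {map P [0..<Suc m]} m 1 N
      (\<lambda>r. if r = 0 then P 0 else c) (\<lambda>r. if r = 0 then P 0 else e) U"
      using that P by (intro N) auto
    then obtain U where U: "stack p Q 1 0 A U" "U 1 0 = c" "U 1 A = e" "U 0 A = P 0"
      "\<And>j s. j < N \<Longrightarrow> s \<le> m \<Longrightarrow> U 0 (j * m + s) = map P [0..<Suc m] ! s"
      by (auto simp: loop_run_def A_def)
    have "U 0 s = P s" if "s \<le> A" for s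
    proof (cases "s = A")
      case True then show ?thesis using U(4) per[of 0 N] by (simp add: A_def)
    next
      case False
      then have "s div m < N" using that m by (simp add: A_def less_mult_imp_div_less)
      moreover have "s mod m \<le> m" "s mod m < Suc m" using m by (simp_all add: less_imp_le less_SucI)
      ultimately have "U 0 s = P (s mod m)"
        using U(5)[of "s div m" "s mod m"] by (simp del: upt_Suc)
      then show ?thesis using per[of "s mod m" "s div m"] by (simp add: add.commute)
    qed
    then show ?thesis using U by blast
  qed
  have main: "\<exists>M. \<forall>k\<ge>M. \<forall>x y. (\<forall>r\<le>h. x r < p \<and> y r < p) \<longrightarrow>
     (\<exists>U a. stack p Q h 0 k U \<and> (\<forall>r\<le>h. U r 0 = x r \<and> U r k = y r) \<and>
        a + T * m \<le> k \<and> (\<forall>s\<le>T * m. U h (a + s) = P s))" for h T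
  proof (induction h arbitrary: T)
    case 0
    show ?case
    proof (intro exI[of _ "T * m + 2"] allI impI)
      fix k and x y :: "nat \<Rightarrow> nat" assume k: "T * m + 2 \<le> k" and xy: "\<forall>r\<le>0. x r < p \<and> y r < p"
      show "\<exists>U a. stack p Q 0 0 k U \<and> (\<forall>r\<le>0. U r 0 = x r \<and> U r k = y r) \<and>
        a + T * m \<le> k \<and> (\<forall>s\<le>T * m. U 0 (a + s) = P s)"
        by (rule exI[of _ "\<lambda>r s. if s = 0 then x 0 else if s = k then y 0 else P (s - 1)"],
            rule exI[of _ 1]) (use k xy P in \<open>auto simp: stack_def\<close>)
    qed
  next
    case (Suc h)
    define C where "C = (T + 1) * m"
    define T' where "T' = N + (T + 1) + N"
    have T'm: "T' * m = A + C + A" by (simp add: T'_def A_def C_def algebra_simps)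
    obtain M where M: "\<And>k x y. M \<le> k \<Longrightarrow> \<forall>r\<le>h. x r < p \<and> y r < p \<Longrightarrow>
     \<exists>U a. stack p Q h 0 k U \<and> (\<forall>r\<le>h. U r 0 = x r \<and> U r k = y r) \<and>
        a + T' * m \<le> k \<and> (\<forall>s\<le>T' * m. U h (a + s) = P s)"
      using Suc.IH[of T'] by blast
    show ?case
    proof (intro exI[of _ M] allI impI)
      fix k and x y :: "nat \<Rightarrow> nat" assume k: "M \<le> k" and xy: "\<forall>r\<le>Suc h. x r < p \<and> y r < p"
      obtain U a where U: "stack p Q h 0 k U" "\<forall>r\<le>h. U r 0 = x r \<and> U r k = y r"
        and a: "a + T' * m \<le> k" "\<forall>s\<le>T' * m. U h (a + s) = P s"
        using M[OF k, of x y] xy by auto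
      define e where "e = k - (a + A + C + A)"
      have k': "k = a + A + C + A + e" using a by (simp add: e_def T'm)
      have f: "U h s < p" if "s \<le> k" for s using stack_entry[OF U(1)] that by simp
      have UP: "U h (a + s) = P s" if "s \<le> A + C + A" for s using a(2) that T'm by simp
      have border: "(if r = 0 then U h 0 else x (Suc h)) < p" "(if r = 0 then U h k else y (Suc h)) < p"
        for r :: nat using f xy by auto
      obtain V1 where V1: "stack p Q 1 0 a V1" "\<forall>s\<le>a. V1 0 s = U h s" "V1 1 0 = x (Suc h)"
        using extend_right[of 0 a "U h" 1 "\<lambda>r. if r = 0 then U h 0 else x (Suc h)"] f k' border by auto
      obtain V5 where V5: "stack p Q 1 0 e V5" "\<forall>s\<le>e. V5 0 s = U h (a + A + C + A + s)" "V5 1 e = y (Suc h)"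
        using extend_left[of 0 e "\<lambda>s. U h (a + A + C + A + s)" 1
            "\<lambda>r. if r = 0 then U h k else y (Suc h)"] f k' border by auto
      obtain V2 where V2: "stack p Q 1 0 A V2" "\<forall>s\<le>A. V2 0 s = P s" "V2 1 0 = V1 1 a" "V2 1 A = P 0"
        using run[of "V1 1 a" "P 0"] P stack_entry[OF V1(1), of 1 a] by auto
      obtain V4 where V4: "stack p Q 1 0 A V4" "\<forall>s\<le>A. V4 0 s = P s" "V4 1 0 = P 0" "V4 1 A = V5 1 0"
        using run[of "P 0" "V5 1 0"] P stack_entry[OF V5(1), of 1 0] by auto
      define V3 where "V3 r s = (if r = 0 then P s else P (s + d))" for r s :: nat
      have V3: "stack p Q 1 0 C V3" using P Q by (simp add: stack_def V3_def)
      have PA: "P (A + s) = P s" "P (C + s) = P s" for s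
        using per[of s N] per[of s "T + 1"] by (simp_all add: A_def C_def add.commute)
      have two: "r = 0 \<or> r = 1" if "r \<le> 1" for r :: nat using that by auto
      obtain W1 where W1: "stack p Q 1 0 (a + A) W1"
          "\<And>r s. r \<le> 1 \<Longrightarrow> s \<le> a \<Longrightarrow> W1 r s = V1 r s"
          "\<And>r s. r \<le> 1 \<Longrightarrow> s \<le> A \<Longrightarrow> W1 r (a + s) = V2 r s"
      proof (rule stack_join[OF V1(1) V2(1)])
        show "V1 r a = V2 r 0" if "r \<le> 1" for r
          using two[OF that] V1 V2 UP[of 0] by auto
      qed blast
      obtain W2 where W2: "stack p Q 1 0 (a + A + C) W2"
          "\<And>r s. r \<le> 1 \<Longrightarrow> s \<le> a + A \<Longrightarrow> W2 r s = W1 r s"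
          "\<And>r s. r \<le> 1 \<Longrightarrow> s \<le> C \<Longrightarrow> W2 r (a + A + s) = V3 r s"
      proof (rule stack_join[OF W1(1) V3])
        show "W1 r (a + A) = V3 r 0" if "r \<le> 1" for r
          using two[OF that] W1(3)[OF that, of A] V2 PA(1)[of 0] d by (auto simp: V3_def)
      qed blast
      obtain W3 where W3: "stack p Q 1 0 (a + A + C + A) W3"
          "\<And>r s. r \<le> 1 \<Longrightarrow> s \<le> a + A + C \<Longrightarrow> W3 r s = W2 r s"
          "\<And>r s. r \<le> 1 \<Longrightarrow> s \<le> A \<Longrightarrow> W3 r (a + A + C + s) = V4 r s"
      proof (rule stack_join[OF W2(1) V4(1)])
        show "W2 r (a + A + C) = V4 r 0" if "r \<le> 1" for r
          using two[OF that] W2(3)[OF that, of C] V4 PA(2)[of 0] PA(2)[of d] d by (auto simp: V3_def)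
      qed blast
      obtain W4 where W4: "stack p Q 1 0 k W4"
          "\<And>r s. r \<le> 1 \<Longrightarrow> s \<le> a + A + C + A \<Longrightarrow> W4 r s = W3 r s"
          "\<And>r s. r \<le> 1 \<Longrightarrow> s \<le> e \<Longrightarrow> W4 r (a + A + C + A + s) = V5 r s"
      proof (rule stack_join[OF W3(1) V5(1)])
        show "W3 r (a + A + C + A) = V5 r 0" if "r \<le> 1" for r
        proof (cases "r = 0")
          case True
          then show ?thesis
            using W3(3)[OF that, of A] V4(2) V5(2) UP[of "A + C + A"] PA(1)[of 0] PA(1)[of "C + A"] PA(2)[of A]
            by (simp add: add.assoc)
        next
          case False
          then show ?thesis using W3(3)[OF that, of A] V4(4) two[OF that] by simp
        qed
      qed (simp_all add: k')
      have W4f: "W4 0 s = U h s" if s: "s \<le> k" for s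
      proof -
        consider "s \<le> a" | t where "s = a + t" "t \<le> A" | t where "s = a + A + t" "t \<le> C"
          | t where "s = a + A + C + t" "t \<le> A" | t where "s = a + A + C + A + t" "t \<le> e"
          using s k' by (metis add_le_cancel_left le_iff_add nle_le)
        then show ?thesis
        proof cases
          case 1 then show ?thesis using W4(2) W3(2) W2(2) W1(2) V1(2) by simp
        next
          case 2 then show ?thesis using W4(2) W3(2) W2(2) W1(3) V2(2) UP by simp
        next
          case 3 then show ?thesis
            using W4(2) W3(2) W2(3) UP[of "A + t"] PA by (simp add: V3_def add.assoc)
        next
          case 4 then show ?thesis
            using W4(2) W3(3) V4(2) UP[of "A + C + t"] PA by (simp add: add.assoc)
        next
          case 5 then show ?thesis using W4(3) V5(2) by simp
        qed
      qed
      obtain Z where Z: "stack p Q (h + 1) 0 k Z" "\<And>r s. r \<le> h \<Longrightarrow> Z r s = U r s"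
          "\<And>r s. r \<le> 1 \<Longrightarrow> 0 \<le> s \<Longrightarrow> s \<le> k \<Longrightarrow> Z (h + r) s = W4 r s"
        using stack_pile[OF U(1) W4(1)] W4f by metis
      have "Z r 0 = x r \<and> Z r k = y r" if "r \<le> Suc h" for r
      proof (cases "r = Suc h")
        case True
        then show ?thesis
          using Z(3)[of 1 0] Z(3)[of 1 k] W4(2)[of 1 0] W3(2)[of 1 0] W2(2)[of 1 0] W1(2)[of 1 0] V1(3)
            W4(3)[of 1 e] V5(3) k' by simp
      next
        case False
        then show ?thesis using Z(2) U(2) that by simp
      qed
      moreover have "Z (Suc h) (a + A + (m - d) + s) = P s" if "s \<le> T * m" for s
      proof -
        have le: "m - d + s \<le> C" using that by (simp add: C_def)
        then have "Z (Suc h) (a + A + (m - d + s)) = P (m - d + s + d)"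
          using Z(3)[of 1 "a + A + (m - d + s)"] W4(2)[of 1 "a + A + (m - d + s)"]
            W3(2)[of 1 "a + A + (m - d + s)"] W2(3)[of 1 "m - d + s"] k' by (simp add: V3_def)
        also have "m - d + s + d = s + m" using d by simp
        finally show ?thesis using P(2) by (simp add: add.assoc)
      qed
      moreover have "a + A + (m - d) + T * m \<le> k" using k' by (simp add: C_def)
      ultimately show "\<exists>U a. stack p Q (Suc h) 0 k U \<and> (\<forall>r\<le>Suc h. U r 0 = x r \<and> U r k = y r) \<and>
        a + T * m \<le> k \<and> (\<forall>s\<le>T * m. U (Suc h) (a + s) = P s)"
        using Z(1) by (intro exI[of _ Z] exI[of _ "a + A + (m - d)"]) simp
    qed
  qed
  have "\<exists>M. \<forall>k\<ge>M. connects p Q h k" for h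
  proof -
    obtain M where M: "\<And>k x y. M \<le> k \<Longrightarrow> \<forall>r\<le>h. x r < p \<and> y r < p \<Longrightarrow>
     \<exists>U a. stack p Q h 0 k U \<and> (\<forall>r\<le>h. U r 0 = x r \<and> U r k = y r) \<and>
        a + 0 * m \<le> k \<and> (\<forall>s\<le>0 * m. U h (a + s) = P s)"
      using main[of h 0] by blast
    have "connects p Q h k" if "M \<le> k" for k
      unfolding connects_def using M[OF that] by blast
    then show ?thesis by blast
  qed
  then show ?thesis unfolding uniformly_connected_def by blast
qed

end

section \<open>Gluing configurations of the plane\<close>

definition config ::
  "nat \<Rightarrow> (nat \<Rightarrow> nat \<Rightarrow> nat \<Rightarrow> nat \<Rightarrow> bool) \<Rightarrow> (int \<Rightarrow> int \<Rightarrow> nat) \<Rightarrow> bool" where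
  "config p Q W \<longleftrightarrow> (\<forall>x y. W x y < p \<and> Q (W x y) (W (x + 1) y) (W x (y + 1)) (W (x + 1) (y + 1)))"

abbreviation (input) transposed ::
  "(nat \<Rightarrow> nat \<Rightarrow> nat \<Rightarrow> nat \<Rightarrow> bool) \<Rightarrow> nat \<Rightarrow> nat \<Rightarrow> nat \<Rightarrow> nat \<Rightarrow> bool" where
  "transposed Q \<equiv> \<lambda>a b c d. Q a c b d"

lemma config_transposed: "config p Q W \<Longrightarrow> config p (transposed Q) (\<lambda>x y. W y x)"
  by (simp add: config_def)

text \<open>
  Below height \<open>d\<close> take \<open>A\<close>; on top of it erect a vertical band which leads to \<open>B\<close>; the two remaining
  quadrants have their lower borders given and are filled in.
\<close>

lemma (in fillable) config_over_half_plane: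
  assumes A: "config p Q A" and B: "config p Q B" and con: "connects p (transposed Q) h k"
  obtains W where "config p Q W" "\<And>x y. y \<le> d \<Longrightarrow> W x y = A x y"
    "\<And>x y. c \<le> x \<Longrightarrow> x \<le> c + int h \<Longrightarrow> d + int k \<le> y \<Longrightarrow> W x y = B x y"
proof -
  have Ap: "A x y < p" and Bp: "B x y < p" for x y using A B by (auto simp: config_def)
  have AQ: "Q (A x y) (A (x + 1) y) (A x (y + 1)) (A (x + 1) (y + 1))"
    and BQ: "Q (B x y) (B (x + 1) y) (B x (y + 1)) (B (x + 1) (y + 1))" for x y
    using A B by (auto simp: config_def)
  obtain U where U: "stack p (transposed Q) h 0 k U"
      "\<forall>r\<le>h. U r 0 = A (c + int r) d \<and> U r k = B (c + int r) (d + int k)"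
    using con[unfolded connects_def, rule_format, of "\<lambda>r. A (c + int r) d" "\<lambda>r. B (c + int r) (d + int k)"]
      Ap Bp by blast
  define band where "band r j = (if j \<le> k then U r j else B (c + int r) (d + int j))" for r j
  have band_p: "band r j < p" if "r \<le> h" for r j
    using stack_entry[OF U(1)] Bp that by (auto simp: band_def)
  have band_Q: "Q (band r j) (band (Suc r) j) (band r (Suc j)) (band (Suc r) (Suc j))" if "r < h" for r j
  proof (cases "j < k")
    case True then show ?thesis using stack_block[OF U(1) that] by (simp add: band_def)
  next
    case False
    then have "band r' j = B (c + int r') (d + int j)" if "r' \<le> h" for r'
      using U(2) that by (auto simp: band_def)
    then show ?thesis
      using False that BQ[of "c + int r" "d + int j"] by (simp add: band_def algebra_simps)
  qed
  have band_0: "band r 0 = A (c + int r) d" if "r \<le> h" for r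
    using U(2) that by (simp add: band_def)
  obtain G where G: "\<forall>i. G i 0 = A (c + int h + int i) d" "\<forall>j. G 0 j = band h j" "\<forall>i j. G i j < p"
      "\<forall>i j. Q (G i j) (G (Suc i) j) (G i (Suc j)) (G (Suc i) (Suc j))"
    using quadrant_extension[of p Q "\<lambda>i. A (c + int h + int i) d" "band h"] fill_right Ap band_p band_0
    by auto
  obtain F where F: "\<forall>i. F i 0 = A (c - int i) d" "\<forall>j. F 0 j = band 0 j" "\<forall>i j. F i j < p"
      "\<forall>i j. Q (F (Suc i) j) (F i j) (F (Suc i) (Suc j)) (F i (Suc j))"
    using quadrant_extension[of p "\<lambda>a b c d. Q b a d c" "\<lambda>i. A (c - int i) d" "band 0"]
      fill_left Ap band_p band_0 by auto
  define W where "W x y = (if y \<le> d then A x y else if x < c then F (nat (c - x)) (nat (y - d))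
     else if x \<le> c + int h then band (nat (x - c)) (nat (y - d))
     else G (nat (x - c - int h)) (nat (y - d)))" for x y
  have W1: "W (c - int i) (d + int j) = F i j" for i j
    using F(1,2) band_0 by (cases "i = 0"; cases "j = 0") (auto simp: W_def)
  have W2: "W (c + int r) (d + int j) = band r j" if "r \<le> h" for r j
    using band_0 that by (cases "j = 0") (auto simp: W_def)
  have W3: "W (c + int h + int i) (d + int j) = G i j" for i j
    using G(1,2) band_0 by (cases "i = 0"; cases "j = 0") (auto simp: W_def)
  have W4: "W x y = A x y" if "y \<le> d" for x y using that by (simp add: W_def)
  have Wp: "W x y < p" for x y
    using Ap F(3) G(3) band_p by (simp add: W_def)
  have WQ: "Q (W x y) (W (x + 1) y) (W x (y + 1)) (W (x + 1) (y + 1))" for x y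
  proof (cases "y < d")
    case True then show ?thesis using W4 AQ by simp
  next
    case False
    then obtain j where y: "y = d + int j" by (metis not_less zle_iff_zadd)
    then have y1: "y + 1 = d + int (Suc j)" by simp
    consider "x < c" | "c \<le> x" "x < c + int h" | "c + int h \<le> x" by linarith
    then show ?thesis
    proof cases
      case 1
      define i where "i = nat (c - x - 1)"
      have x: "x = c - int (Suc i)" "x + 1 = c - int i" using 1 by (simp_all add: i_def)
      show ?thesis unfolding x(2) unfolding y1 x(1) unfolding y W1 using F(4) by blast
    next
      case 2
      define r where "r = nat (x - c)"
      have x: "x = c + int r" "x + 1 = c + int (Suc r)" "r < h" using 2 by (simp_all add: r_def)
      show ?thesis unfolding x(2) unfolding y1 x(1) unfolding y
        using band_Q[OF x(3), of j] W2[of r j] W2[of "Suc r" j] W2[of r "Suc j"] W2[of "Suc r" "Suc j"]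
          x(3) by simp
    next
      case 3
      define i where "i = nat (x - c - int h)"
      have x: "x = c + int h + int i" "x + 1 = c + int h + int (Suc i)" using 3 by (simp_all add: i_def)
      show ?thesis unfolding x(2) unfolding y1 x(1) unfolding y W3 using G(4) by blast
    qed
  qed
  have "W x y = B x y" if x: "c \<le> x" "x \<le> c + int h" and y: "d + int k \<le> y" for x y
  proof -
    define r j where "r = nat (x - c)" and "j = nat (y - d)"
    have r: "x = c + int r" "r \<le> h" and j: "y = d + int j" "k \<le> j"
      using x y by (auto simp: r_def j_def)
    show ?thesis using W2[OF r(2), of j] U(2) r j by (cases "j = k") (auto simp: band_def)
  qed
  then show thesis using that[of W] Wp WQ W4 by (simp add: config_def)
qed

lemma (in fillable) config_vertical_mixing:
  assumes A: "config p Q A" and B: "config p Q B" and k0: "\<And>k. k0 \<le> k \<Longrightarrow> connects p (transposed Q) (2 * n) k"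
    and dist: "2 * int n + int k0 \<le> \<bar>v2\<bar>"
  obtains W where "config p Q W"
    "\<And>x y. \<bar>x\<bar> \<le> int n \<Longrightarrow> \<bar>y\<bar> \<le> int n \<Longrightarrow> W x y = A x y"
    "\<And>x y. \<bar>x - v1\<bar> \<le> int n \<Longrightarrow> \<bar>y - v2\<bar> \<le> int n \<Longrightarrow> W x y = B x y"
proof (cases "v2 \<ge> 0")
  case True
  define k where "k = nat (v2 - 2 * int n)"
  have k: "k0 \<le> k" "int k = v2 - 2 * int n" using dist True by (auto simp: k_def)
  show thesis
  proof (rule config_over_half_plane[OF A B k0[OF k(1)], where d = "int n" and c = "v1 - int n"])
    fix W assume "config p Q W" "\<And>x y. y \<le> int n \<Longrightarrow> W x y = A x y"
      "\<And>x y. v1 - int n \<le> x \<Longrightarrow> x \<le> v1 - int n + int (2 * n) \<Longrightarrow> int n + int k \<le> y \<Longrightarrow> W x y = B x y"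
    then show thesis using k by (intro that[of W]) auto
  qed
next
  case False
  define k where "k = nat (- v2 - 2 * int n)"
  have k: "k0 \<le> k" "int k = - v2 - 2 * int n" using dist False by (auto simp: k_def)
  show thesis
  proof (rule config_over_half_plane[OF B A k0[OF k(1)], where d = "v2 + int n" and c = "- int n"])
    fix W assume "config p Q W" "\<And>x y. y \<le> v2 + int n \<Longrightarrow> W x y = B x y"
      "\<And>x y. - int n \<le> x \<Longrightarrow> x \<le> - int n + int (2 * n) \<Longrightarrow> v2 + int n + int k \<le> y \<Longrightarrow> W x y = A x y"
    then show thesis using k by (intro that[of W]) auto
  qed
qed

lemma config_mixing:
  assumes Q: "fillable p Q" and Q': "fillable p (transposed Q)"
    and con: "uniformly_connected p Q" and con': "uniformly_connected p (transposed Q)"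
  obtains N where "\<And>v1 v2 A B. int N \<le> \<bar>v1\<bar> \<or> int N \<le> \<bar>v2\<bar> \<Longrightarrow> config p Q A \<Longrightarrow> config p Q B \<Longrightarrow>
    \<exists>W. config p Q W \<and> (\<forall>x y. \<bar>x\<bar> \<le> int n \<and> \<bar>y\<bar> \<le> int n \<longrightarrow> W x y = A x y) \<and>
      (\<forall>x y. \<bar>x - v1\<bar> \<le> int n \<and> \<bar>y - v2\<bar> \<le> int n \<longrightarrow> W x y = B x y)"
proof -
  obtain k where k: "\<And>k'. k \<le> k' \<Longrightarrow> connects p Q (2 * n) k'"
    using con unfolding uniformly_connected_def by blast
  obtain k' where k': "\<And>k''. k' \<le> k'' \<Longrightarrow> connects p (transposed Q) (2 * n) k''"
    using con' unfolding uniformly_connected_def by blast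
  show thesis
  proof (rule that[of "2 * n + k + k'"])
    fix v1 v2 A B
    assume v: "int (2 * n + k + k') \<le> \<bar>v1\<bar> \<or> int (2 * n + k + k') \<le> \<bar>v2\<bar>"
      and AB: "config p Q A" "config p Q B"
    show "\<exists>W. config p Q W \<and> (\<forall>x y. \<bar>x\<bar> \<le> int n \<and> \<bar>y\<bar> \<le> int n \<longrightarrow> W x y = A x y) \<and>
      (\<forall>x y. \<bar>x - v1\<bar> \<le> int n \<and> \<bar>y - v2\<bar> \<le> int n \<longrightarrow> W x y = B x y)"
      using v
    proof
      assume v1: "int (2 * n + k + k') \<le> \<bar>v1\<bar>"
      have AB': "config p (transposed Q) (\<lambda>x y. A y x)" "config p (transposed Q) (\<lambda>x y. B y x)"
        using AB config_transposed by blast+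
      obtain W where W: "config p (transposed Q) W"
        "\<And>x y. \<bar>x\<bar> \<le> int n \<Longrightarrow> \<bar>y\<bar> \<le> int n \<Longrightarrow> W x y = A y x"
        "\<And>x y. \<bar>x - v2\<bar> \<le> int n \<Longrightarrow> \<bar>y - v1\<bar> \<le> int n \<Longrightarrow> W x y = B y x"
        by (rule fillable.config_vertical_mixing[OF Q' AB', of k n v1 v2]) (use k v1 in auto)
      show ?thesis using config_transposed[OF W(1)] W by (intro exI[of _ "\<lambda>x y. W y x"]) auto
    next
      assume v2: "int (2 * n + k + k') \<le> \<bar>v2\<bar>"
      obtain W where W: "config p Q W"
        "\<And>x y. \<bar>x\<bar> \<le> int n \<Longrightarrow> \<bar>y\<bar> \<le> int n \<Longrightarrow> W x y = A x y"
        "\<And>x y. \<bar>x - v1\<bar> \<le> int n \<Longrightarrow> \<bar>y - v2\<bar> \<le> int n \<Longrightarrow> W x y = B x y"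
        by (rule fillable.config_vertical_mixing[OF Q, of A B k' n v2 v1]) (use AB k' v2 in auto)
      then show ?thesis by blast
    qed
  qed
qed

lemma rect_2_2: "rect 2 2 (0, 0) = {(0, 0), (1, 0), (0, 1), (1, 1)}"
proof -
  have "rect 2 2 (0, 0) = (\<lambda>(a, b). (int a, int b)) ` ({0, 1} \<times> {0, 1})"
    unfolding rect_def by (force simp: less_2_cases_iff)
  then show ?thesis by auto
qed

definition block_in :: "(int \<times> int \<Rightarrow> nat) set \<Rightarrow> nat \<Rightarrow> nat \<Rightarrow> nat \<Rightarrow> nat \<Rightarrow> bool" where
  "block_in B a b c d \<longleftrightarrow>
     restrict (\<lambda>w. if w = (0, 0) then a else if w = (1, 0) then b else if w = (0, 1) then c else d)
       (rect 2 2 (0, 0)) \<in> B"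

lemma restrict_block:
  "restrict (\<lambda>w. U ((x, y) + w)) (rect 2 2 (0, 0)) \<in> B \<longleftrightarrow>
     block_in B (U (x, y)) (U (x + 1, y)) (U (x, y + 1)) (U (x + 1, y + 1))"
proof -
  have "restrict (\<lambda>w. U ((x, y) + w)) (rect 2 2 (0, 0)) =
    restrict (\<lambda>w. if w = (0, 0) then U (x, y) else if w = (1, 0) then U (x + 1, y)
      else if w = (0, 1) then U (x, y + 1) else U (x + 1, y + 1)) (rect 2 2 (0, 0))"
    by (rule restrict_ext) (auto simp: rect_2_2)
  then show ?thesis by (simp add: block_in_def)
qed

lemma shift_space_iff_config: "U \<in> shift_space p B \<longleftrightarrow> config p (block_in B) (\<lambda>x y. U (x, y))"
proof -
  have "admissible B UNIV U \<longleftrightarrow>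
      (\<forall>x y. block_in B (U (x, y)) (U (x + 1, y)) (U (x, y + 1)) (U (x + 1, y + 1)))"
    unfolding admissible_def by (simp add: restrict_block)
  then show ?thesis
    by (auto simp: shift_space_def patterns_def config_def PiE_iff)
qed

lemma lattice_dist_translate_le:
  assumes a: "a \<in> R1" "\<bar>fst a\<bar> \<le> int n" "\<bar>snd a\<bar> \<le> int n"
    and b: "b \<in> R2" "\<bar>fst b\<bar> \<le> int n" "\<bar>snd b\<bar> \<le> int n"
  shows "lattice_dist R1 (translate v R2) \<le> 4 * real n + real_of_int (\<bar>fst v\<bar> + \<bar>snd v\<bar>)"
proof -
  let ?f = "map_prod real_of_int real_of_int"
  have "lattice_dist R1 (translate v R2) \<le> dist (?f a) (?f (b + v))"
    unfolding lattice_dist_def translate_def using a b by (intro setdist_le_dist) auto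
  also have "\<dots> \<le> dist (fst (?f a)) (fst (?f (b + v))) + dist (snd (?f a)) (snd (?f (b + v)))"
    unfolding dist_prod_def by (rule sqrt_sum_squares_le_sum) auto
  also have "\<dots> = real_of_int (\<bar>fst a - fst b - fst v\<bar> + \<bar>snd a - snd b - snd v\<bar>)"
    by (simp add: dist_real_def algebra_simps)
  also have "\<dots> \<le> real_of_int (4 * int n + \<bar>fst v\<bar> + \<bar>snd v\<bar>)"
    unfolding of_int_le_iff using a b by linarith
  finally show ?thesis by simp
qed

lemma topologically_mixing_shift_space:
  assumes "fillable p (block_in B)" "fillable p (transposed (block_in B))"
    and "uniformly_connected p (block_in B)" "uniformly_connected p (transposed (block_in B))"
  shows "topologically_mixing (shift_space p B)"
  unfolding topologically_mixing_def
proof (intro allI impI)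
  fix R1 R2 :: "(int \<times> int) set" assume fin: "finite R1 \<and> finite R2"
  define n where "n = nat (Max (insert 0 ((\<lambda>a. max \<bar>fst a\<bar> \<bar>snd a\<bar>) ` (R1 \<union> R2))))"
  have max_le: "max \<bar>fst a\<bar> \<bar>snd a\<bar> \<le> int n" if "a \<in> R1 \<union> R2" for a
  proof -
    have "max \<bar>fst a\<bar> \<bar>snd a\<bar> \<le> Max (insert 0 ((\<lambda>a. max \<bar>fst a\<bar> \<bar>snd a\<bar>) ` (R1 \<union> R2)))"
      using fin that by (intro Max_ge) auto
    then show ?thesis unfolding n_def by linarith
  qed
  have n: "\<bar>fst a\<bar> \<le> int n" "\<bar>snd a\<bar> \<le> int n" if "a \<in> R1 \<union> R2" for a
    using max_le[OF that] by simp_all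
  obtain N where N: "\<And>v1 v2 A B'. int N \<le> \<bar>v1\<bar> \<or> int N \<le> \<bar>v2\<bar> \<Longrightarrow> config p (block_in B) A \<Longrightarrow>
    config p (block_in B) B' \<Longrightarrow>
    \<exists>W. config p (block_in B) W \<and> (\<forall>x y. \<bar>x\<bar> \<le> int n \<and> \<bar>y\<bar> \<le> int n \<longrightarrow> W x y = A x y) \<and>
      (\<forall>x y. \<bar>x - v1\<bar> \<le> int n \<and> \<bar>y - v2\<bar> \<le> int n \<longrightarrow> W x y = B' x y)"
    by (rule config_mixing[OF assms, of n]) blast
  define M :: real where "M = 4 * n + 2 * N + 1"
  have "\<exists>W\<in>shift_space p B. restrict W R1 = restrict U1 R1 \<and>
      restrict W (translate v R2) = restrict U2 (translate v R2)"
    if dist: "M \<le> lattice_dist R1 (translate v R2)"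
      and U: "U1 \<in> shift_space p B" "U2 \<in> shift_space p B" for v U1 U2
  proof (cases "R1 = {} \<or> R2 = {}")
    case True
    then have "lattice_dist R1 (translate v R2) = 0" by (auto simp: lattice_dist_def translate_def)
    then show ?thesis using dist by (simp add: M_def)
  next
    case False
    then obtain a b where ab: "a \<in> R1" "b \<in> R2" by blast
    have "M \<le> 4 * real n + real_of_int (\<bar>fst v\<bar> + \<bar>snd v\<bar>)"
      using lattice_dist_translate_le[of a R1 n b R2 v] ab n[of a] n[of b] dist by simp
    then have "int N \<le> \<bar>fst v\<bar> \<or> int N \<le> \<bar>snd v\<bar>" unfolding M_def by linarith
    from N[OF this, of "\<lambda>x y. U1 (x, y)" "\<lambda>x y. U2 (x, y)"] U
    obtain W where W: "config p (block_in B) W"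
        "\<forall>x y. \<bar>x\<bar> \<le> int n \<and> \<bar>y\<bar> \<le> int n \<longrightarrow> W x y = U1 (x, y)"
        "\<forall>x y. \<bar>x - fst v\<bar> \<le> int n \<and> \<bar>y - snd v\<bar> \<le> int n \<longrightarrow> W x y = U2 (x, y)"
      by (auto simp: shift_space_iff_config)
    have "restrict (case_prod W) R1 = restrict U1 R1"
      using n W(2) by (intro restrict_ext) (auto simp: case_prod_unfold)
    moreover have "restrict (case_prod W) (translate v R2) = restrict U2 (translate v R2)"
    proof (rule restrict_ext)
      fix w assume "w \<in> translate v R2"
      then obtain b where b: "b \<in> R2" "w = b + v" by (auto simp: translate_def)
      then show "case_prod W w = U2 w"
        using n[of b] W(3)[rule_format, of "fst w" "snd w"] by (simp add: case_prod_unfold plus_prod_def)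
    qed
    ultimately show ?thesis
      using W(1) by (intro bexI[of _ "case_prod W"]) (auto simp: shift_space_iff_config)
  qed
  then show "\<exists>M. \<forall>v. M \<le> lattice_dist R1 (translate v R2) \<longrightarrow>
    (\<forall>U1\<in>(\<lambda>W. restrict W R1) ` shift_space p B.
      \<forall>U2\<in>(\<lambda>W. restrict W (translate v R2)) ` shift_space p B.
        \<exists>W\<in>shift_space p B. restrict W R1 = U1 \<and> restrict W (translate v R2) = U2)"
    by (intro exI[of _ M]) blast
qed

section \<open>Words and columns as matrix indices\<close>

lemma psi_Nil [simp]: "psi p [] = 1"
  by (simp add: psi_def)

lemma psi_Cons [simp]: "psi p (u # us) = u * p ^ length us + psi p us"
proof -
  have "(\<Sum>k=Suc 0..Suc (length us). (u # us) ! (k - 1) * p ^ (Suc (length us) - k)) =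
      u * p ^ length us + (\<Sum>k=Suc (Suc 0)..Suc (length us). (u # us) ! (k - 1) * p ^ (Suc (length us) - k))"
    by (subst sum.atLeast_Suc_atMost) simp_all
  also have "(\<Sum>k=Suc (Suc 0)..Suc (length us). (u # us) ! (k - 1) * p ^ (Suc (length us) - k)) =
      (\<Sum>k=Suc 0..length us. us ! (k - 1) * p ^ (length us - k))"
    unfolding sum.shift_bounds_cl_Suc_ivl by (rule sum.cong) (auto simp: nth_Cons')
  finally show ?thesis by (simp add: psi_def)
qed

lemma psi_pos: "1 \<le> psi p us"
  by (simp add: psi_def)

lemma psi_le: "set us \<subseteq> {..<p} \<Longrightarrow> psi p us \<le> p ^ length us"
proof (induction us)
  case (Cons u us)
  then have "u * p ^ length us + psi p us \<le> u * p ^ length us + p ^ length us" by simp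
  also have "\<dots> = Suc u * p ^ length us" by simp
  also have "\<dots> \<le> p * p ^ length us" using Cons.prems by (intro mult_le_mono1) auto
  finally show ?case by simp
qed simp

lemma psi_inj:
  assumes "length us = length vs" "set us \<subseteq> {..<p}" "set vs \<subseteq> {..<p}" "psi p us = psi p vs"
  shows "us = vs"
  using assms
proof (induction us vs rule: list_induct2)
  case (Cons u us v vs)
  define r where "r = p ^ length us"
  obtain a where a: "psi p us = Suc a" using psi_pos[of p us] by (cases "psi p us") auto
  obtain b where b: "psi p vs = Suc b" using psi_pos[of p vs] by (cases "psi p vs") auto
  have lt: "a < r" "b < r" using psi_le[of us p] psi_le[of vs p] Cons a b by (simp_all add: r_def)
  have eq: "u * r + a = v * r + b" using Cons a b by (simp add: r_def)
  have "u = (u * r + a) div r" "v = (v * r + b) div r" using lt by simp_all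
  with eq have "u = v" by simp
  then show ?case using Cons eq a b by simp
qed simp

lemma psi_surj: "1 \<le> a \<Longrightarrow> a \<le> p ^ n \<Longrightarrow> \<exists>us. length us = n \<and> set us \<subseteq> {..<p} \<and> psi p us = a"
proof (induction n arbitrary: a)
  case 0 then show ?case by (intro exI[of _ "[]"]) simp
next
  case (Suc n)
  define u r where "u = (a - 1) div p ^ n" and "r = (a - 1) mod p ^ n"
  have P: "0 < p ^ n" using Suc.prems by (cases "p ^ n") auto
  have "u < p" using Suc.prems by (simp add: u_def less_mult_imp_div_less)
  moreover obtain us where us: "length us = n" "set us \<subseteq> {..<p}" "psi p us = Suc r"
    using Suc.IH[of "Suc r"] P by (auto simp: r_def Suc_le_eq)
  moreover have "u * p ^ n + r = a - 1" unfolding u_def r_def by (rule div_mult_mod_eq)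
  ultimately show ?case using Suc.prems by (intro exI[of _ "u # us"]) auto
qed

lemma unpsi_psi [simp]:
  "length us = n \<Longrightarrow> set us \<subseteq> {..<p} \<Longrightarrow> unpsi p n (psi p us) = us"
  unfolding unpsi_def by (rule the_equality) (auto intro: psi_inj)

lemma unpsi:
  assumes "1 \<le> a" "a \<le> p ^ n"
  shows length_unpsi: "length (unpsi p n a) = n" and set_unpsi: "set (unpsi p n a) \<subseteq> {..<p}"
    and psi_unpsi: "psi p (unpsi p n a) = a"
  using psi_surj[OF assms] by auto

text \<open>Here \<open>i\<close> is counted from 0, as in library matrices, whereas the values of \<open>psi\<close> start at 1.\<close>

definition column :: "nat \<Rightarrow> nat \<Rightarrow> nat \<Rightarrow> nat \<Rightarrow> nat \<Rightarrow> nat" where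
  "column p h b i r = (b # unpsi p h (Suc i)) ! r"

lemma column_0 [simp]: "column p h b i 0 = b"
  by (simp add: column_def)

lemma column_less: "b < p \<Longrightarrow> i < p ^ h \<Longrightarrow> r \<le> h \<Longrightarrow> column p h b i r < p"
  using set_unpsi[of "Suc i" p h] length_unpsi[of "Suc i" p h]
  by (cases r) (auto simp: column_def subset_iff)

lemma column_surj:
  assumes "\<And>r. r \<le> h \<Longrightarrow> x r < p" "x 0 = b"
  obtains i where "i < p ^ h" "\<And>r. r \<le> h \<Longrightarrow> column p h b i r = x r"
proof -
  let ?u = "map x [1..<Suc h]"
  have u: "length ?u = h" "set ?u \<subseteq> {..<p}" using assms(1) by auto
  have i: "Suc (psi p ?u - 1) = psi p ?u" using psi_pos[of p ?u] by simp
  have "column p h b (psi p ?u - 1) r = x r" if "r \<le> h" for r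
    unfolding column_def i unpsi_psi[OF u] using assms(2) that by (cases r) (auto simp del: upt_Suc)
  moreover have "psi p ?u - 1 < p ^ h" using psi_le[OF u(2)] psi_pos[of p ?u] unfolding u(1) by linarith
  ultimately show thesis using that by blast
qed

definition realizes :: "nat \<Rightarrow> (nat \<Rightarrow> nat \<Rightarrow> nat \<Rightarrow> nat \<Rightarrow> bool) \<Rightarrow> nat \<Rightarrow> nat mat \<Rightarrow> bool" where
  "realizes p Q n A \<longleftrightarrow> A \<in> carrier_mat (p ^ n) (p ^ n) \<and>
     (\<forall>us vs. length us = n \<longrightarrow> length vs = n \<longrightarrow> set us \<subseteq> {..<p} \<longrightarrow> set vs \<subseteq> {..<p} \<longrightarrow>
        0 < A $$ (psi p us - 1, psi p vs - 1) \<longrightarrow>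
        (\<forall>t. Suc t < n \<longrightarrow> Q (us ! t) (vs ! t) (us ! Suc t) (vs ! Suc t)))"

lemma realizes_column:
  assumes A: "realizes p Q (Suc h) A" and ab: "a < p" "b < p" and ij: "i < p ^ h" "j < p ^ h"
    and pos: "0 < A $$ (a * p ^ h + i, b * p ^ h + j)" and r: "r < h"
  shows "Q (column p h a i r) (column p h b j r) (column p h a i (Suc r)) (column p h b j (Suc r))"
proof -
  have "psi p (a # unpsi p h (Suc i)) - 1 = a * p ^ h + i" "psi p (b # unpsi p h (Suc j)) - 1 = b * p ^ h + j"
    using length_unpsi[of "Suc i" p h] length_unpsi[of "Suc j" p h]
      psi_unpsi[of "Suc i" p h] psi_unpsi[of "Suc j" p h] ij by simp_all
  then show ?thesis
    using A[unfolded realizes_def, THEN conjunct2, rule_format, of "a # unpsi p h (Suc i)" "b # unpsi p h (Suc j)" r]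
      length_unpsi[of "Suc i" p h] length_unpsi[of "Suc j" p h]
      set_unpsi[of "Suc i" p h] set_unpsi[of "Suc j" p h] ab ij pos r by (simp add: column_def)
qed

lemma mat_block_psi_pair:
  "a < p \<Longrightarrow> b < p \<Longrightarrow> mat_block_psi p r A (psi p [a, b]) = mat_block r A (Suc a) (Suc b)"
  unfolding mat_block_psi_def by (subst unpsi_psi) auto

lemma fillable_of_non_degenerated:
  assumes p: "0 < p" and A: "realizes p Q 2 A" and nd: "non_degenerated p A"
  shows "fillable p Q"
proof
  show "0 < p" by (rule p)
  have A': "realizes p Q (Suc 1) A" using A by (simp add: numeral_2_eq_2)
  have col: "column p 1 a c (Suc 0) = c" if "c < p" for a c
    using unpsi_psi[of "[c]" 1 p] that by (simp add: column_def)
  have block: "Q a b c d" if "a < p" "b < p" "c < p" "d < p" "mat_block p A (Suc a) (Suc b) $$ (c, d) \<noteq> 0" for a b c d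
    using realizes_column[OF A', of a b c d 0] that col[of c a] col[of d b] by (simp add: mat_block_def)
  have nc: "non_compressible (mat_block p A (Suc a) (Suc b))" if "a < p" "b < p" for a b
  proof -
    have "psi p [a, b] \<le> p\<^sup>2" using psi_le[of "[a, b]" p] that by (simp add: power2_eq_square)
    then show ?thesis
      using nd psi_pos[of p "[a, b]"] mat_block_psi_pair[OF that, of p A]
      unfolding non_degenerated_def by (metis atLeastAtMost_iff)
  qed
  have dim: "dim_row (mat_block p A i j) = p" "dim_col (mat_block p A i j) = p" for i j
    by (simp_all add: mat_block_def)
  fix a b assume ab: "a < p" "b < p"
  show "\<exists>d<p. Q a b c d" if c: "c < p" for c
  proof -
    have "row (mat_block p A (Suc a) (Suc b)) c \<noteq> 0\<^sub>v p"
      using nc[OF ab] c by (simp add: non_compressible_def dim)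
    then have "\<exists>d<p. mat_block p A (Suc a) (Suc b) $$ (c, d) \<noteq> 0"
      using c by (auto simp: Matrix.vec_eq_iff dim)
    then show ?thesis using block ab c by blast
  qed
  show "\<exists>c<p. Q a b c d" if d: "d < p" for d
  proof -
    have "col (mat_block p A (Suc a) (Suc b)) d \<noteq> 0\<^sub>v p"
      using nc[OF ab] d by (simp add: non_compressible_def dim)
    then have "\<exists>c<p. mat_block p A (Suc a) (Suc b) $$ (c, d) \<noteq> 0"
      using d by (auto simp: Matrix.vec_eq_iff dim)
    then show ?thesis using block ab d by blast
  qed
qed

lemma mat_mult_pos:
  fixes A B :: "nat mat"
  assumes "A \<in> carrier_mat r r" "B \<in> carrier_mat r r" "i < r" "j < r" "0 < (A * B) $$ (i, j)"
  obtains k where "k < r" "0 < A $$ (i, k)" "0 < B $$ (k, j)"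
proof -
  have eq: "(A * B) $$ (i, j) = (\<Sum>k = 0..<r. A $$ (i, k) * B $$ (k, j))"
    using assms by (simp add: scalar_prod_def)
  have "(\<Sum>k = 0..<r. A $$ (i, k) * B $$ (k, j)) \<noteq> 0"
    using gr_implies_not0[OF assms(5)] unfolding eq .
  then obtain k where "k \<in> {0..<r}" "A $$ (i, k) * B $$ (k, j) \<noteq> 0"
    by (rule sum.not_neutral_contains_not_neutral)
  then show thesis using that[of k] by simp
qed

lemma mat_list_prod_carrier:
  "\<forall>A\<in>set As. A \<in> carrier_mat r r \<Longrightarrow> mat_list_prod r As \<in> carrier_mat r r"
  by (induction As) (auto simp: mat_list_prod_def)

lemma mat_list_prod_path:
  assumes "\<forall>A\<in>set As. A \<in> carrier_mat r r" "i < r" "j < r" "0 < mat_list_prod r As $$ (i, j)"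
  shows "\<exists>\<sigma>. \<sigma> 0 = i \<and> \<sigma> (length As) = j \<and> (\<forall>k\<le>length As. \<sigma> k < r) \<and>
     (\<forall>k<length As. 0 < (As ! k) $$ (\<sigma> k, \<sigma> (Suc k)))"
  using assms
proof (induction As arbitrary: i)
  case Nil
  then have "i = j" by (auto simp: mat_list_prod_def split: if_splits)
  then show ?case using Nil by (intro exI[of _ "\<lambda>_. i"]) simp
next
  case (Cons A As)
  have "mat_list_prod r (A # As) = A * mat_list_prod r As" by (simp add: mat_list_prod_def)
  then obtain k where k: "k < r" "0 < A $$ (i, k)" "0 < mat_list_prod r As $$ (k, j)"
    using mat_mult_pos[of A r "mat_list_prod r As" i j] mat_list_prod_carrier[of As r] Cons.prems by auto
  then obtain \<sigma> where s: "\<sigma> 0 = k" "\<sigma> (length As) = j" "\<forall>k\<le>length As. \<sigma> k < r"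
      "\<forall>k<length As. 0 < (As ! k) $$ (\<sigma> k, \<sigma> (Suc k))"
    using Cons.IH[of k] Cons.prems by auto
  have "0 < ((A # As) ! l) $$ (case_nat i \<sigma> l, case_nat i \<sigma> (Suc l))" if "l < Suc (length As)" for l
    using s k that by (cases l) auto
  moreover have "case_nat i \<sigma> l < r" if "l \<le> Suc (length As)" for l
    using s Cons.prems that by (cases l) auto
  ultimately show ?case using s by (intro exI[of _ "case_nat i \<sigma>"]) simp
qed

lemma pow_mat_path:
  fixes A :: "nat mat"
  assumes "A \<in> carrier_mat r r" "i < r" "j < r" "0 < (A ^\<^sub>m n) $$ (i, j)"
  shows "\<exists>\<sigma>. \<sigma> 0 = i \<and> \<sigma> n = j \<and> (\<forall>k\<le>n. \<sigma> k < r) \<and> (\<forall>k<n. 0 < A $$ (\<sigma> k, \<sigma> (Suc k)))"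
  using assms
proof (induction n arbitrary: j)
  case 0
  then have "i = j" by (auto split: if_splits)
  then show ?case using 0 by (intro exI[of _ "\<lambda>_. i"]) simp
next
  case (Suc n)
  obtain k where k: "k < r" "0 < (A ^\<^sub>m n) $$ (i, k)" "0 < A $$ (k, j)"
    using Suc.prems(4) unfolding pow_mat.simps
    by (rule mat_mult_pos[OF pow_carrier_mat[OF Suc.prems(1)] Suc.prems(1-3)])
  then obtain \<sigma> where s: "\<sigma> 0 = i" "\<sigma> n = k" "\<forall>k\<le>n. \<sigma> k < r" "\<forall>k<n. 0 < A $$ (\<sigma> k, \<sigma> (Suc k))"
    using Suc.IH[of k] Suc.prems by auto
  show ?case
    by (rule exI[of _ "\<sigma>(Suc n := j)"]) (use s k Suc.prems in \<open>auto simp: less_Suc_eq le_Suc_eq\<close>)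
qed

lemma elementary_pair:
  assumes "b < p" "length u = m - 1" "set u \<subseteq> {..<p}"
  shows "elementary p r A m (psi p [b, b]) (psi p u) =
    mat_list_prod r (map (\<lambda>i. mat_block r A (Suc ((b # u @ [b]) ! i)) (Suc ((b # u @ [b]) ! Suc i))) [0..<m])"
proof -
  have w: "unpsi p 2 (psi p [b, b]) = [b, b]" using assms by (intro unpsi_psi) auto
  have js: "map Suc ([b, b] ! 0 # u @ [[b, b] ! 1]) ! i = Suc ((b # u @ [b]) ! i)" if "i \<le> m" for i
    using assms that by (subst nth_map) auto
  show ?thesis
    unfolding elementary_def Let_def w unpsi_psi[OF assms(2,3)]
  proof (intro arg_cong[of _ _ "mat_list_prod r"] map_cong refl)
    fix i assume "i \<in> set [0..<m]"
    then have i: "i \<le> m" "i + 1 \<le> m" by auto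
    show "mat_block r A (map Suc ([b, b] ! 0 # u @ [[b, b] ! 1]) ! i)
        (map Suc ([b, b] ! 0 # u @ [[b, b] ! 1]) ! (i + 1)) =
      mat_block r A (Suc ((b # u @ [b]) ! i)) (Suc ((b # u @ [b]) ! Suc i))"
      unfolding js[OF i(1)] js[OF i(2)] by simp
  qed
qed

lemma elementary_pos_stack:
  assumes A: "realizes p Q (Suc h) A" and m: "0 < m" and b: "b < p" and u: "length u = m - 1" "set u \<subseteq> {..<p}"
    and ij: "i < p ^ h" "j < p ^ h"
    and pos: "0 < elementary p (p ^ h) A m (psi p [b, b]) (psi p u) $$ (i, j)"
  shows "\<exists>U. stack p Q h 0 m U \<and> (\<forall>r\<le>h. U r 0 = column p h b i r \<and> U r m = column p h b j r) \<and>
    (\<forall>s\<le>m. U 0 s = (b # u @ [b]) ! s)"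
proof -
  let ?w = "b # u @ [b]"
  let ?As = "map (\<lambda>i. mat_block (p ^ h) A (Suc (?w ! i)) (Suc (?w ! Suc i))) [0..<m]"
  have len: "length ?w = Suc m" using u m by simp
  have wp: "?w ! s < p" if "s \<le> m" for s
  proof -
    have "?w ! s \<in> set ?w" using len that by (intro nth_mem) linarith
    then show ?thesis using b u by auto
  qed
  have "\<exists>\<sigma>. \<sigma> 0 = i \<and> \<sigma> (length ?As) = j \<and> (\<forall>k\<le>length ?As. \<sigma> k < p ^ h) \<and>
     (\<forall>k<length ?As. 0 < (?As ! k) $$ (\<sigma> k, \<sigma> (Suc k)))"
    using pos ij unfolding elementary_pair[OF b u]
    by (intro mat_list_prod_path) (auto simp: mat_block_def)
  then obtain \<sigma> where s: "\<sigma> 0 = i" "\<sigma> m = j" "\<forall>k\<le>m. \<sigma> k < p ^ h"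
      "\<forall>k<m. 0 < mat_block (p ^ h) A (Suc (?w ! k)) (Suc (?w ! Suc k)) $$ (\<sigma> k, \<sigma> (Suc k))"
    by auto
  let ?U = "\<lambda>r s. column p h (?w ! s) (\<sigma> s) r"
  have "Q (?U r k) (?U r (Suc k)) (?U (Suc r) k) (?U (Suc r) (Suc k))" if "r < h" "k < m" for r k
  proof (rule realizes_column[OF A])
    show "0 < A $$ (?w ! k * p ^ h + \<sigma> k, ?w ! Suc k * p ^ h + \<sigma> (Suc k))"
      using s(3,4) that by (auto simp: mat_block_def simp del: append.simps nth_Cons_Suc)
  qed (use wp[of k] wp[of "Suc k"] s(3) that in auto)
  then have "stack p Q h 0 m ?U"
    unfolding stack_def using column_less wp s(3) by blast
  moreover have "?w ! m = b" using u m by (cases m) (auto simp: nth_append)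
  ultimately show ?thesis using s by (intro exI[of _ ?U]) simp
qed

lemma loop_connected_of_primitive:
  assumes A: "realizes p Q (Suc h) A" and m: "0 < m" and b: "b < p" and K: "K \<subseteq> {1..p ^ (m - 1)}"
    and M: "M \<in> carrier_mat (p ^ h) (p ^ h)" "primitive_mat M"
    and pos: "\<And>i j. i < p ^ h \<Longrightarrow> j < p ^ h \<Longrightarrow> 0 < M $$ (i, j) \<Longrightarrow>
      \<exists>k\<in>K. 0 < elementary p (p ^ h) A m (psi p [b, b]) k $$ (i, j)"
  shows "loop_connected p Q ((\<lambda>k. b # unpsi p (m - 1) k @ [b]) ` K) m b h"
proof -
  let ?L = "(\<lambda>k. b # unpsi p (m - 1) k @ [b]) ` K"
  obtain N0 where N0: "\<forall>n\<ge>N0. \<forall>i<p ^ h. \<forall>j<p ^ h. 0 < (M ^\<^sub>m n) $$ (i, j)"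
    using M unfolding primitive_mat_def by auto
  have step: "\<exists>U. stack p Q h 0 m U \<and> (\<forall>r\<le>h. U r 0 = column p h b i r \<and> U r m = column p h b j r) \<and>
      (\<exists>w\<in>?L. \<forall>s\<le>m. U 0 s = w ! s)" if ij: "i < p ^ h" "j < p ^ h" "0 < M $$ (i, j)" for i j
  proof -
    obtain k where k: "k \<in> K" "0 < elementary p (p ^ h) A m (psi p [b, b]) k $$ (i, j)"
      using pos[OF ij] by blast
    have k': "1 \<le> k" "k \<le> p ^ (m - 1)" using K k(1) by auto
    show ?thesis
      using elementary_pos_stack[OF A m b length_unpsi[OF k'] set_unpsi[OF k'] ij(1,2)] k
      unfolding psi_unpsi[OF k'] by (meson imageI)
  qed
  have "\<exists>U. loop_run p Q ?L m h N x y U"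
    if N: "N0 \<le> N" and x: "\<And>r. r \<le> h \<Longrightarrow> x r < p" "x 0 = b" and y: "\<And>r. r \<le> h \<Longrightarrow> y r < p" "y 0 = b" for N x y
  proof -
    obtain i where i: "i < p ^ h" "\<And>r. r \<le> h \<Longrightarrow> column p h b i r = x r"
      using column_surj[of h x p b] x by blast
    obtain j where j: "j < p ^ h" "\<And>r. r \<le> h \<Longrightarrow> column p h b j r = y r"
      using column_surj[of h y p b] y by blast
    obtain \<sigma> where s: "\<sigma> 0 = i" "\<sigma> N = j" "\<forall>k\<le>N. \<sigma> k < p ^ h" "\<forall>k<N. 0 < M $$ (\<sigma> k, \<sigma> (Suc k))"
      using pow_mat_path[OF M(1) i(1) j(1) N0[rule_format, OF N i(1) j(1)]] by blast
    have "\<forall>k. \<exists>U. k < N \<longrightarrow> stack p Q h 0 m U \<and>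
      (\<forall>r\<le>h. U r 0 = column p h b (\<sigma> k) r \<and> U r m = column p h b (\<sigma> (Suc k)) r) \<and>
      (\<exists>w\<in>?L. \<forall>s\<le>m. U 0 s = w ! s)"
    proof
      fix k
      show "\<exists>U. k < N \<longrightarrow> stack p Q h 0 m U \<and>
        (\<forall>r\<le>h. U r 0 = column p h b (\<sigma> k) r \<and> U r m = column p h b (\<sigma> (Suc k)) r) \<and>
        (\<exists>w\<in>?L. \<forall>s\<le>m. U 0 s = w ! s)"
        using step[of "\<sigma> k" "\<sigma> (Suc k)"] s(3,4) by (cases "k < N") auto
    qed
    from choice[OF this] obtain R where R: "\<And>k. k < N \<longrightarrow> stack p Q h 0 m (R k) \<and>
      (\<forall>r\<le>h. R k r 0 = column p h b (\<sigma> k) r \<and> R k r m = column p h b (\<sigma> (Suc k)) r) \<and>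
      (\<exists>w\<in>?L. \<forall>s\<le>m. R k 0 s = w ! s)" by blast
    have "\<exists>M. stack p Q h 0 (N * m) M \<and>
        (\<forall>r\<le>h. M r 0 = column p h b (\<sigma> 0) r \<and> M r (N * m) = column p h b (\<sigma> N) r) \<and>
        (\<forall>k<N. \<forall>r\<le>h. \<forall>s\<le>m. M r (k * m + s) = R k r s)"
      using R column_less[OF b] s(3) by (intro stack_tile[where c = "\<lambda>k. column p h b (\<sigma> k)"]) auto
    then obtain V where V: "stack p Q h 0 (N * m) V"
        "\<forall>r\<le>h. V r 0 = column p h b (\<sigma> 0) r \<and> V r (N * m) = column p h b (\<sigma> N) r"
        "\<forall>k<N. \<forall>r\<le>h. \<forall>s\<le>m. V r (k * m + s) = R k r s" by blast
    have "\<exists>w\<in>?L. \<forall>s\<le>m. V 0 (k * m + s) = w ! s" if "k < N" for k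
      using R[of k] V(3) that by simp
    then have "loop_run p Q ?L m h N x y V"
      unfolding loop_run_def using V s i j by simp
    then show ?thesis by blast
  qed
  then show ?thesis unfolding loop_connected_def by blast
qed

section \<open>Cycles\<close>

definition conn_realizes ::
  "nat \<Rightarrow> (nat \<Rightarrow> nat \<Rightarrow> nat \<Rightarrow> nat \<Rightarrow> bool) \<Rightarrow> nat \<Rightarrow> (nat \<Rightarrow> nat \<Rightarrow> nat mat) \<Rightarrow> bool" where
  "conn_realizes p Q m T \<longleftrightarrow> (\<forall>\<alpha> \<beta>. T \<alpha> \<beta> \<in> carrier_mat (p ^ (m - 1)) (p ^ (m - 1))) \<and>
     (\<forall>a b u v. a < p \<longrightarrow> b < p \<longrightarrow> length u = m - 1 \<longrightarrow> length v = m - 1 \<longrightarrow>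
        set u \<subseteq> {..<p} \<longrightarrow> set v \<subseteq> {..<p} \<longrightarrow>
        0 < T (psi p [a, a]) (psi p [b, b]) $$ (psi p u - 1, psi p v - 1) \<longrightarrow>
        (\<forall>s<m. Q ((a # u @ [a]) ! s) ((a # u @ [a]) ! Suc s) ((b # v @ [b]) ! s) ((b # v @ [b]) ! Suc s)))"

lemma conn_realizes_unpsi:
  assumes T: "conn_realizes p Q m T" and ab: "a < p" "b < p" and ij: "i < p ^ (m - 1)" "j < p ^ (m - 1)"
    and pos: "0 < T (psi p [a, a]) (psi p [b, b]) $$ (i, j)" and s: "s < m"
  defines "w \<equiv> \<lambda>b i. b # unpsi p (m - 1) (Suc i) @ [b]"
  shows "Q (w a i ! s) (w a i ! Suc s) (w b j ! s) (w b j ! Suc s)"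
proof -
  have i: "1 \<le> Suc i" "Suc i \<le> p ^ (m - 1)" and j: "1 \<le> Suc j" "Suc j \<le> p ^ (m - 1)" using ij by auto
  show ?thesis unfolding w_def
  proof (rule T[unfolded conn_realizes_def, THEN conjunct2, rule_format])
    show "0 < T (psi p [a, a]) (psi p [b, b]) $$
        (psi p (unpsi p (m - 1) (Suc i)) - 1, psi p (unpsi p (m - 1) (Suc j)) - 1)"
      unfolding psi_unpsi[OF i] psi_unpsi[OF j] using pos by (simp del: psi_Cons)
  qed (use ab s length_unpsi[OF i] length_unpsi[OF j] set_unpsi[OF i] set_unpsi[OF j] in auto)
qed

lemma loop_word:
  assumes b: "b < p" and k: "k \<in> {1..p ^ (m - 1)}" and m: "0 < m"
  shows "(b # unpsi p (m - 1) k @ [b]) ! m = b"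
    and "s \<le> m \<Longrightarrow> (b # unpsi p (m - 1) k @ [b]) ! s < p"
proof -
  have u: "length (unpsi p (m - 1) k) = m - 1" "set (unpsi p (m - 1) k) \<subseteq> {..<p}"
    using length_unpsi[of k p "m - 1"] set_unpsi[of k p "m - 1"] k by auto
  then show "(b # unpsi p (m - 1) k @ [b]) ! m = b" using m by (cases m) (auto simp: nth_append)
  assume "s \<le> m"
  then have "(b # unpsi p (m - 1) k @ [b]) ! s \<in> set (b # unpsi p (m - 1) k @ [b])"
    using u m by (intro nth_mem) simp
  then show "(b # unpsi p (m - 1) k @ [b]) ! s < p" using b u by auto
qed

lemma diag_index_eq_psi: "\<beta> \<in> diag_indices p \<Longrightarrow> \<exists>b<p. \<beta> = psi p [b, b]"
  by (auto simp: diag_indices_def algebra_simps)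

lemma elementary_carrier: "elementary p r A m \<alpha> k \<in> carrier_mat r r"
  unfolding elementary_def Let_def by (intro mat_list_prod_carrier) (auto simp: mat_block_def)

lemma uniformly_connected_of_invariant_diagonal_cycle:
  assumes Q: "fillable p Q" and A: "\<And>n. realizes p Q n (A n)" and T: "\<And>m. 2 \<le> m \<Longrightarrow> conn_realizes p Q m (T m)"
    and cyc: "invariant_diagonal_cycle p T m \<beta>s K"
    and prim: "\<And>n. 2 \<le> n \<Longrightarrow> n \<le> length \<beta>s + 1 \<Longrightarrow>
      primitive_mat (mat_set_sum (p ^ (n - 1)) (\<lambda>l. elementary p (p ^ (n - 1)) (A n) m (hd \<beta>s) l) K)"
  shows "uniformly_connected p Q"
proof -
  interpret fillable p Q by (rule Q)
  define q where "q = length \<beta>s"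
  let ?P = "mat_list_prod (p ^ (m - 1)) (map (\<lambda>i. T m (\<beta>s ! i) (\<beta>s ! ((i + 1) mod q))) [0..<q])"
  have m: "2 \<le> m" and q: "1 \<le> q" and diag: "set \<beta>s \<subseteq> diag_indices p" and K: "K \<subseteq> {1..p ^ (m - 1)}"
    and inv: "\<forall>l\<in>K. (\<Sum>k\<in>K. entry ?P k l) \<ge> 1"
    using cyc unfolding invariant_diagonal_cycle_def q_def by auto
  have "\<forall>i. \<exists>b. i < q \<longrightarrow> b < p \<and> \<beta>s ! i = psi p [b, b]"
    using diag diag_index_eq_psi nth_mem unfolding q_def by (metis subsetD)
  from choice[OF this] obtain bb where bb: "\<And>i. i < q \<longrightarrow> bb i < p \<and> \<beta>s ! i = psi p [bb i, bb i]" by blast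
  define bs where "bs i = bb (i mod q)" for i
  have bs: "bs i < p" "\<beta>s ! (i mod q) = psi p [bs i, bs i]" for i
    using bb[of "i mod q"] q by (auto simp: bs_def)
  define b where "b = bs 0"
  have hd: "hd \<beta>s = psi p [b, b]"
    using bs(2)[of 0] q by (simp add: b_def q_def hd_conv_nth Suc_le_eq del: psi_Cons)
  define w where "w b i = b # unpsi p (m - 1) (Suc i) @ [b]" for b i
  have w: "w b i ! 0 = b" "w b i ! m = b" "s \<le> m \<Longrightarrow> w b i ! s < p" if "b < p" "i < p ^ (m - 1)" for b i s
    using loop_word[OF that(1), of "Suc i" m] that(2) m unfolding w_def by auto
  let ?L = "(\<lambda>k. b # unpsi p (m - 1) k @ [b]) ` K"
  have L: "loop_connected p Q ?L m b q"
  proof (rule loop_connected_of_primitive[OF A])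
    let ?M = "mat_set_sum (p ^ q) (\<lambda>l. elementary p (p ^ q) (A (Suc q)) m (psi p [b, b]) l) K"
    show "0 < m" "b < p" "K \<subseteq> {1..p ^ (m - 1)}" using m bs K by (auto simp: b_def)
    show "?M \<in> carrier_mat (p ^ q) (p ^ q)" by (simp add: mat_set_sum_def)
    show "primitive_mat ?M" using prim[of "Suc q"] q hd by (simp add: q_def del: psi_Cons)
    fix i j assume "i < p ^ q" "j < p ^ q" "0 < ?M $$ (i, j)"
    then have "(\<Sum>k\<in>K. elementary p (p ^ q) (A (Suc q)) m (psi p [b, b]) k $$ (i, j)) \<noteq> 0"
      by (simp add: mat_set_sum_def del: psi_Cons)
    then obtain k where "k \<in> K" "elementary p (p ^ q) (A (Suc q)) m (psi p [b, b]) k $$ (i, j) \<noteq> 0"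
      by (rule sum.not_neutral_contains_not_neutral)
    then show "\<exists>k\<in>K. 0 < elementary p (p ^ q) (A (Suc q)) m (psi p [b, b]) k $$ (i, j)" by blast
  qed
  have bsq: "bs q = b" by (simp add: b_def bs_def)
  show ?thesis
  proof (rule uniformly_connected_of_loops[where bs = bs, OF L])
    show "0 < q" "0 < m" using q m by auto
    show "bs i < p" for i by (rule bs)
    show "bs 0 = b" "bs q = b" using bsq by (simp_all add: b_def)
    fix x assume "x \<in> ?L"
    then obtain l where l: "l \<in> K" and x: "x = b # unpsi p (m - 1) l @ [b]" by blast
    have "(\<Sum>k\<in>K. entry ?P k l) \<noteq> 0" using inv l by (metis not_one_le_zero)
    then obtain k where k: "k \<in> K" "entry ?P k l \<noteq> 0" by (rule sum.not_neutral_contains_not_neutral)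
    have kl: "k - 1 < p ^ (m - 1)" "l - 1 < p ^ (m - 1)" "Suc (k - 1) = k" "Suc (l - 1) = l"
      using K k(1) l by (auto simp: subset_iff)
    have carrier: "\<forall>M\<in>set (map (\<lambda>i. T m (\<beta>s ! i) (\<beta>s ! ((i + 1) mod q))) [0..<q]).
        M \<in> carrier_mat (p ^ (m - 1)) (p ^ (m - 1))"
      using T[OF m] unfolding conn_realizes_def by auto
    have "0 < ?P $$ (k - 1, l - 1)" using k(2) by (simp add: entry_def)
    from mat_list_prod_path[OF carrier kl(1,2) this]
    obtain \<sigma> where s: "\<sigma> 0 = k - 1" "\<sigma> q = l - 1" "\<forall>i\<le>q. \<sigma> i < p ^ (m - 1)"
        "\<forall>i<q. 0 < T m (\<beta>s ! i) (\<beta>s ! ((i + 1) mod q)) $$ (\<sigma> i, \<sigma> (Suc i))"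
      by (auto simp del: One_nat_def)
    let ?R = "\<lambda>i s. w (bs i) (\<sigma> i) ! s"
    have "Q (?R i s) (?R i (Suc s)) (?R (Suc i) s) (?R (Suc i) (Suc s))" if "i < q" "s < m" for i s
      unfolding w_def
    proof (rule conn_realizes_unpsi[OF T[OF m]])
      show "0 < T m (psi p [bs i, bs i]) (psi p [bs (Suc i), bs (Suc i)]) $$ (\<sigma> i, \<sigma> (Suc i))"
        using s(4)[rule_format, OF that(1)] bs(2)[of "i + 1"] bs(2)[of i] that(1)
        by (simp only: mod_less Suc_eq_plus1)
    qed (use bs s(3) that in auto)
    then have "stack p Q q 0 m ?R"
      unfolding stack_def using w(3)[OF bs(1)] s(3) by blast
    moreover have "?R q s = x ! s" "?R 0 s = (b # unpsi p (m - 1) k @ [b]) ! s" for s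
      using s kl bsq by (simp_all add: w_def x b_def)
    ultimately show "\<exists>R. stack p Q q 0 m R \<and> (\<forall>i\<le>q. R i 0 = bs i \<and> R i m = bs i) \<and>
        (\<forall>s\<le>m. R q s = x ! s) \<and> (\<exists>w'\<in>?L. \<forall>s\<le>m. R 0 s = w' ! s)"
      using w(1,2)[OF bs(1)] s(3) k(1) by (intro exI[of _ ?R]) auto
  qed
qed

lemma uniformly_connected_of_commutative_cycle_pair:
  assumes Q: "fillable p Q" and A: "realizes p Q 2 A" and T: "conn_realizes p Q m T"
    and pair: "commutative_cycle_pair p I J" and ind: "cycle_pair_index p I J = (m, \<alpha>, K, L)"
    and prim: "primitive_mat (elementary p p A m \<alpha> K)" and T1: "entry (T \<alpha> \<alpha>) K L = 1"
  shows "uniformly_connected p Q"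
proof -
  interpret fillable p Q by (rule Q)
  have IJ: "I \<noteq> []" "J \<noteq> []" "set I \<subseteq> {1..p}" "set J \<subseteq> {1..p}" "hd J = hd I"
    using pair unfolding commutative_cycle_pair_def by auto
  have dec: "x - 1 < p" if "x \<in> set I \<union> set J" for x
  proof -
    have "x \<in> {1..p}" using IJ that by blast
    then show ?thesis by auto
  qed
  define I' where "I' = map (\<lambda>x. x - 1) I"
  define J' where "J' = map (\<lambda>x. x - 1) J"
  define b where "b = hd I - 1"
  have I': "I' \<noteq> []" "set I' \<subseteq> {..<p}" "hd I' = b" and J': "J' \<noteq> []" "set J' \<subseteq> {..<p}" "hd J' = b"
    using IJ dec by (auto simp: I'_def J'_def b_def hd_map simp del: One_nat_def)
  have b: "b < p" using I' hd_in_set[of I'] by auto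
  let ?K = "tl I' @ b # tl J'" and ?L = "tl J' @ b # tl I'"
  have m: "m = length I' + length J'" and \<alpha>: "\<alpha> = psi p [b, b]" and K: "K = psi p ?K" and L: "L = psi p ?L"
    using ind by (auto simp: cycle_pair_index_def I'_def J'_def b_def map_tl simp del: psi_Cons)
  have wK: "b # ?K @ [b] = I' @ J' @ [b]" and wL: "b # ?L @ [b] = J' @ I' @ [b]"
    using I'(1,3) J'(1,3) by (cases I'; cases J'; auto)+
  have len: "length ?K = m - 1" "length ?L = m - 1" using I' J' by (cases I'; cases J'; auto simp: m)+
  have sets: "set ?K \<subseteq> {..<p}" "set ?L \<subseteq> {..<p}"
    using I' J' b by (cases I'; cases J'; auto)+
  have m2: "2 \<le> m" using I' J' by (cases I'; cases J') (auto simp: m)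
  define P where "P s = (I' @ J') ! (s mod m)" for s
  define d where "d = length I'"
  have d: "0 < d" "d < m" using I' J' by (auto simp: d_def m)
  have Pp: "P s < p" for s
  proof -
    have "P s \<in> set (I' @ J')" unfolding P_def using m2 by (intro nth_mem) (simp add: m[symmetric])
    then show ?thesis using I' J' by auto
  qed
  have P0: "P 0 = b" using I' by (simp add: P_def nth_append hd_conv_nth)
  have Pd: "P d = b" using d J' by (simp add: P_def nth_append hd_conv_nth d_def)
  have Pm: "P (s + m) = P s" for s by (simp add: P_def)
  have PK: "(b # ?K @ [b]) ! s = P s" if "s \<le> m" for s
    unfolding wK using that Pm[of 0] P0
    by (cases "s = m") (auto simp: P_def nth_append m)
  have PL: "(b # ?L @ [b]) ! s = P (s + d)" if sm: "s \<le> m" for s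
  proof -
    consider "s < length J'" | "length J' \<le> s" "s < m" | "s = m" using sm by linarith
    then show ?thesis
    proof cases
      case 1
      then have "P (s + d) = J' ! s" by (simp add: P_def d_def m nth_append)
      then show ?thesis unfolding wL using 1 by (simp add: nth_append)
    next
      case 2
      then have "s + d = (s - length J') + m" "s - length J' < d" by (auto simp: m d_def)
      then have "P (s + d) = I' ! (s - length J')"
        using Pm[of "s - length J'"] d by (simp add: P_def nth_append d_def)
      moreover have "s - length J' < length I'" using 2 by (simp add: m less_diff_conv2)
      ultimately show ?thesis unfolding wL using 2 by (simp add: nth_append)
    next
      case 3
      then have "P (s + d) = b" using Pm[of d] Pd by (simp add: add.commute)
      then show ?thesis unfolding wL using 3 by (simp add: nth_append m)
    qed
  qed
  have Kr: "1 \<le> K" "K \<le> p ^ (m - 1)"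
    using psi_pos[of p ?K] psi_le[OF sets(1)] unfolding len(1) K by simp_all
  have "loop_connected p Q ((\<lambda>k. b # unpsi p (m - 1) k @ [b]) ` {K}) m b 1"
  proof (rule loop_connected_of_primitive)
    show "realizes p Q (Suc 1) A" using A by (simp add: numeral_2_eq_2)
    show "elementary p p A m (psi p [b, b]) K \<in> carrier_mat (p ^ 1) (p ^ 1)"
      using elementary_carrier[of p p] by simp
    show "primitive_mat (elementary p p A m (psi p [b, b]) K)" using prim \<alpha> by simp
  qed (use m2 b Kr in auto)
  moreover have "b # unpsi p (m - 1) K @ [b] = map P [0..<Suc m]"
  proof (rule nth_equalityI)
    show "length (b # unpsi p (m - 1) K @ [b]) = length (map P [0..<Suc m])"
      using length_unpsi[OF Kr] m2 by simp
    fix s assume "s < length (b # unpsi p (m - 1) K @ [b])"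
    then have "s \<le> m" using length_unpsi[OF Kr] m2 by simp
    then show "(b # unpsi p (m - 1) K @ [b]) ! s = map P [0..<Suc m] ! s"
      using PK unfolding K unpsi_psi[OF len(1) sets(1)] by (simp add: nth_map del: upt_Suc)
  qed
  ultimately have loop: "loop_connected p Q {map P [0..<Suc m]} m (P 0) 1"
    by (simp only: P0 image_insert image_empty)
  have base: "Q (P s) (P (Suc s)) (P (s + d)) (P (Suc s + d))" if "s < m" for s
  proof -
    have "Q ((b # ?K @ [b]) ! s) ((b # ?K @ [b]) ! Suc s) ((b # ?L @ [b]) ! s) ((b # ?L @ [b]) ! Suc s)"
      using T[unfolded conn_realizes_def, THEN conjunct2, rule_format, OF b b len sets _ that] T1
      by (simp add: entry_def \<alpha> K L del: psi_Cons)
    then show ?thesis using PK[of s] PK[of "Suc s"] PL[of s] PL[of "Suc s"] that by simp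
  qed
  have "P (s + e) = P (s mod m + e)" for s e
    by (simp add: P_def mod_add_left_eq)
  from this[of _ 0] this[of _ 1] this[of _ d] this[of _ "Suc d"]
  have mod: "P s = P (s mod m)" "P (Suc s) = P (Suc (s mod m))" "P (s + d) = P (s mod m + d)"
      "P (Suc s + d) = P (Suc (s mod m) + d)" for s
    by simp_all
  have "Q (P s) (P (Suc s)) (P (s + d)) (P (Suc s + d))" for s
    unfolding mod[of s] using m2 by (intro base) simp
  moreover have "0 < m" "d \<le> m" "P d = P 0" using m2 d Pd P0 by simp_all
  ultimately show ?thesis using uniformly_connected_of_shift[OF loop _ Pp Pm, of d] by blast
qed

lemma cycle_pair_index_swap:
  assumes "commutative_cycle_pair p I J" "cycle_pair_index p I J = (m, \<alpha>, K, L)"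
  shows "commutative_cycle_pair p J I" "cycle_pair_index p J I = (m, \<alpha>, L, K)"
  using assms by (auto simp: commutative_cycle_pair_def cycle_pair_index_def)

lemma uniformly_connected_of_cycles:
  assumes Q: "fillable p Q" and A: "\<And>n. realizes p Q n (A n)" and T: "\<And>m. 2 \<le> m \<Longrightarrow> conn_realizes p Q m (T m)"
    and cycles: "(\<exists>m \<beta>s K. invariant_diagonal_cycle p T m \<beta>s K \<and>
            (\<forall>n. 2 \<le> n \<and> n \<le> length \<beta>s + 1 \<longrightarrow>
              primitive_mat (mat_set_sum (p ^ (n - 1)) (\<lambda>l. elementary p (p ^ (n - 1)) (A n) m (hd \<beta>s) l) K)))
         \<or> (\<exists>I J m \<alpha> K L. commutative_cycle_pair p I J \<and> cycle_pair_index p I J = (m, \<alpha>, K, L) \<and>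
              primitive_mat (elementary p p (A 2) m \<alpha> K) \<and> primitive_mat (elementary p p (A 2) m \<alpha> L) \<and>
              (entry (T m \<alpha> \<alpha>) K L = 1 \<or> entry (T m \<alpha> \<alpha>) L K = 1))"
  shows "uniformly_connected p Q"
  using cycles
proof (elim disjE exE conjE)
  fix m \<beta>s K assume "invariant_diagonal_cycle p T m \<beta>s K"
    "\<forall>n. 2 \<le> n \<and> n \<le> length \<beta>s + 1 \<longrightarrow>
      primitive_mat (mat_set_sum (p ^ (n - 1)) (\<lambda>l. elementary p (p ^ (n - 1)) (A n) m (hd \<beta>s) l) K)"
  then show ?thesis
    using uniformly_connected_of_invariant_diagonal_cycle[OF Q A T] by blast
next
  fix I J m \<alpha> K L
  assume pair: "commutative_cycle_pair p I J" and ind: "cycle_pair_index p I J = (m, \<alpha>, K, L)"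
    and prim: "primitive_mat (elementary p p (A 2) m \<alpha> K)" "primitive_mat (elementary p p (A 2) m \<alpha> L)"
  have "2 \<le> m" using pair ind by (auto simp: commutative_cycle_pair_def cycle_pair_index_def)
  note T = T[OF this]
  show ?thesis if "entry (T m \<alpha> \<alpha>) K L = 1"
    using uniformly_connected_of_commutative_cycle_pair[OF Q A T pair ind prim(1) that] .
  show ?thesis if "entry (T m \<alpha> \<alpha>) L K = 1"
    using uniformly_connected_of_commutative_cycle_pair[OF Q A T cycle_pair_index_swap[OF pair ind] prim(2) that] .
qed

lemma rect_2_2_subset_iff:
  "rect 2 2 v \<subseteq> rect m n (0, 0) \<longleftrightarrow> (\<exists>i j. v = (int i, int j) \<and> Suc i < m \<and> Suc j < n)"
proof
  assume sub: "rect 2 2 v \<subseteq> rect m n (0, 0)"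
  have "v \<in> rect 2 2 v" "(fst v + 1, snd v + 1) \<in> rect 2 2 v"
    unfolding rect_def by (force intro: exI[of _ "0 :: nat"] exI[of _ "1 :: nat"])+
  then have "v \<in> rect m n (0, 0)" "(fst v + 1, snd v + 1) \<in> rect m n (0, 0)" using sub by auto
  then show "\<exists>i j. v = (int i, int j) \<and> Suc i < m \<and> Suc j < n" unfolding rect_def by force
next
  assume "\<exists>i j. v = (int i, int j) \<and> Suc i < m \<and> Suc j < n"
  then obtain i j where v: "v = (int i, int j)" "Suc i < m" "Suc j < n" by blast
  show "rect 2 2 v \<subseteq> rect m n (0, 0)"
  proof
    fix x assume "x \<in> rect 2 2 v"
    then obtain a c where "x = (int (i + a), int (j + c))" "a < 2" "c < 2" by (auto simp: rect_def v)
    moreover from this have "i + a < m" "j + c < n" using v by auto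
    ultimately show "x \<in> rect m n (0, 0)"
      unfolding rect_def by (intro CollectI exI[of _ "i + a"] exI[of _ "j + c"]) simp
  qed
qed

lemma admissible_rect_block:
  assumes "admissible B (rect m n (0, 0)) U" "Suc i < m" "Suc j < n"
  shows "block_in B (U (int i, int j)) (U (int (Suc i), int j))
    (U (int i, int (Suc j))) (U (int (Suc i), int (Suc j)))"
proof -
  have "rect 2 2 (int i, int j) \<subseteq> rect m n (0, 0)" using assms(2,3) by (auto simp: rect_2_2_subset_iff)
  then have "block_in B (U (int i, int j)) (U (int i + 1, int j)) (U (int i, int j + 1)) (U (int i + 1, int j + 1))"
    using assms(1) unfolding admissible_def restrict_block[symmetric] by blast
  then show ?thesis by (simp add: add.commute)
qed

lemma patterns_rect_less:
  "U \<in> patterns p (rect m n (0, 0)) \<Longrightarrow> i < m \<Longrightarrow> j < n \<Longrightarrow> U (int i, int j) < p"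
  unfolding patterns_def rect_def by (auto simp: PiE_iff)

lemma mat_of_rel_psi_pos:
  assumes "0 < mat_of_rel (p ^ n) R $$ (psi p us - 1, psi p vs - 1)"
    and "length us = n" "length vs = n" "set us \<subseteq> {..<p}" "set vs \<subseteq> {..<p}"
  shows "R (psi p us) (psi p vs)"
proof -
  have "psi p us - 1 < p ^ n"
    using psi_le[OF assms(4)] psi_pos[of p us] unfolding assms(2) by linarith
  moreover have "psi p vs - 1 < p ^ n"
    using psi_le[OF assms(5)] psi_pos[of p vs] unfolding assms(3) by linarith
  ultimately show ?thesis
    using assms(1) psi_pos[of p us] psi_pos[of p vs] by (simp add: mat_of_rel_def split: if_splits)
qed

lemma realizes_H_matrix: "realizes p (block_in B) n (H_matrix p B n)"
  unfolding realizes_def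
proof (intro conjI allI impI)
  show "H_matrix p B n \<in> carrier_mat (p ^ n) (p ^ n)" by (simp add: H_matrix_def mat_of_rel_def)
  fix us vs t
  assume len: "length us = n" "length vs = n" and sets: "set us \<subseteq> {..<p}" "set vs \<subseteq> {..<p}"
    and pos: "0 < H_matrix p B n $$ (psi p us - 1, psi p vs - 1)" and t: "Suc t < n"
  obtain U where U: "U \<in> patterns p (rect 2 n (0, 0))" "psi p us = psi p (map (\<lambda>t. U (0, int t)) [0..<n])"
      "psi p vs = psi p (map (\<lambda>t. U (1, int t)) [0..<n])" "admissible B (rect 2 n (0, 0)) U"
    using mat_of_rel_psi_pos[OF pos[unfolded H_matrix_def] len sets] by blast
  have "us = map (\<lambda>t. U (0, int t)) [0..<n]"
    using patterns_rect_less[OF U(1), of 0] len sets by (intro psi_inj[OF _ _ _ U(2)]) auto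
  moreover have "vs = map (\<lambda>t. U (1, int t)) [0..<n]"
    using patterns_rect_less[OF U(1), of 1] len sets by (intro psi_inj[OF _ _ _ U(3)]) auto
  ultimately show "block_in B (us ! t) (vs ! t) (us ! Suc t) (vs ! Suc t)"
    using admissible_rect_block[OF U(4), of 0 t] t by simp
qed

lemma realizes_V_matrix: "realizes p (transposed (block_in B)) n (V_matrix p B n)"
  unfolding realizes_def
proof (intro conjI allI impI)
  show "V_matrix p B n \<in> carrier_mat (p ^ n) (p ^ n)" by (simp add: V_matrix_def mat_of_rel_def)
  fix us vs t
  assume len: "length us = n" "length vs = n" and sets: "set us \<subseteq> {..<p}" "set vs \<subseteq> {..<p}"
    and pos: "0 < V_matrix p B n $$ (psi p us - 1, psi p vs - 1)" and t: "Suc t < n"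
  obtain U where U: "U \<in> patterns p (rect n 2 (0, 0))" "psi p us = psi p (map (\<lambda>s. U (int s, 0)) [0..<n])"
      "psi p vs = psi p (map (\<lambda>s. U (int s, 1)) [0..<n])" "admissible B (rect n 2 (0, 0)) U"
    using mat_of_rel_psi_pos[OF pos[unfolded V_matrix_def] len sets] by blast
  have "us = map (\<lambda>s. U (int s, 0)) [0..<n]"
    using patterns_rect_less[OF U(1), of _ 0] len sets by (intro psi_inj[OF _ _ _ U(2)]) auto
  moreover have "vs = map (\<lambda>s. U (int s, 1)) [0..<n]"
    using patterns_rect_less[OF U(1), of _ 1] len sets by (intro psi_inj[OF _ _ _ U(3)]) auto
  ultimately show "block_in B (us ! t) (us ! Suc t) (vs ! t) (vs ! Suc t)"
    using admissible_rect_block[OF U(4), of t 0] t by simp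
qed

lemma loop_word_eq_map:
  assumes "psi p [a, a] = psi p [f 0, f m]" "psi p u = psi p (map f [1..<m])"
    and "\<And>s. s \<le> m \<Longrightarrow> f s < p" "a < p" "length u = m - 1" "set u \<subseteq> {..<p}" "1 \<le> m"
  shows "a # u @ [a] = map f [0..<Suc m]"
proof -
  have "[a, a] = [f 0, f m]" using assms(3,4) by (intro psi_inj[OF _ _ _ assms(1)]) auto
  moreover have "u = map f [1..<m]" using assms(3,5,6) by (intro psi_inj[OF _ _ _ assms(2)]) auto
  moreover have "[0..<Suc m] = 0 # [1..<m] @ [m]" using assms(7) by (simp add: upt_conv_Cons)
  ultimately show ?thesis by simp
qed

lemma conn_realizes_S_conn:
  assumes m: "2 \<le> m"
  shows "conn_realizes p (block_in B) m (S_conn p B m)"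
  unfolding conn_realizes_def
proof (intro conjI allI impI)
  show "S_conn p B m \<alpha> \<beta> \<in> carrier_mat (p ^ (m - 1)) (p ^ (m - 1))" for \<alpha> \<beta>
    by (simp add: S_conn_def mat_of_rel_def)
  fix a b u v s
  assume ab: "a < p" "b < p" and len: "length u = m - 1" "length v = m - 1"
    and sets: "set u \<subseteq> {..<p}" "set v \<subseteq> {..<p}"
    and pos: "0 < S_conn p B m (psi p [a, a]) (psi p [b, b]) $$ (psi p u - 1, psi p v - 1)" and s: "s < m"
  obtain U where U: "U \<in> patterns p (rect (m + 1) 2 (0, 0))"
      "psi p [a, a] = psi p [U (0, 0), U (int m, 0)]" "psi p [b, b] = psi p [U (0, 1), U (int m, 1)]"
      "psi p u = psi p (map (\<lambda>s. U (int s, 0)) [1..<m])" "psi p v = psi p (map (\<lambda>s. U (int s, 1)) [1..<m])"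
      "admissible B (rect (m + 1) 2 (0, 0)) U"
    using mat_of_rel_psi_pos[OF pos[unfolded S_conn_def] len sets] by blast
  have w: "a # u @ [a] = map (\<lambda>s. U (int s, 0)) [0..<Suc m]" "b # v @ [b] = map (\<lambda>s. U (int s, 1)) [0..<Suc m]"
    using patterns_rect_less[OF U(1), of _ 0] patterns_rect_less[OF U(1), of _ 1] ab len sets m U(2-5)
    by (intro loop_word_eq_map; simp del: psi_Cons upt_Suc)+
  show "block_in B ((a # u @ [a]) ! s) ((a # u @ [a]) ! Suc s) ((b # v @ [b]) ! s) ((b # v @ [b]) ! Suc s)"
    unfolding w using admissible_rect_block[OF U(6), of s 0] s by (simp del: upt_Suc)
qed

lemma conn_realizes_W_conn:
  assumes m: "2 \<le> m"
  shows "conn_realizes p (transposed (block_in B)) m (W_conn p B m)"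
  unfolding conn_realizes_def
proof (intro conjI allI impI)
  show "W_conn p B m \<alpha> \<beta> \<in> carrier_mat (p ^ (m - 1)) (p ^ (m - 1))" for \<alpha> \<beta>
    by (simp add: W_conn_def mat_of_rel_def)
  fix a b u v s
  assume ab: "a < p" "b < p" and len: "length u = m - 1" "length v = m - 1"
    and sets: "set u \<subseteq> {..<p}" "set v \<subseteq> {..<p}"
    and pos: "0 < W_conn p B m (psi p [a, a]) (psi p [b, b]) $$ (psi p u - 1, psi p v - 1)" and s: "s < m"
  obtain U where U: "U \<in> patterns p (rect 2 (m + 1) (0, 0))"
      "psi p [a, a] = psi p [U (0, 0), U (0, int m)]" "psi p [b, b] = psi p [U (1, 0), U (1, int m)]"
      "psi p u = psi p (map (\<lambda>s. U (0, int s)) [1..<m])" "psi p v = psi p (map (\<lambda>s. U (1, int s)) [1..<m])"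
      "admissible B (rect 2 (m + 1) (0, 0)) U"
    using mat_of_rel_psi_pos[OF pos[unfolded W_conn_def] len sets] by blast
  have w: "a # u @ [a] = map (\<lambda>s. U (0, int s)) [0..<Suc m]" "b # v @ [b] = map (\<lambda>s. U (1, int s)) [0..<Suc m]"
    using patterns_rect_less[OF U(1), of 0] patterns_rect_less[OF U(1), of 1] ab len sets m U(2-5)
    by (intro loop_word_eq_map; simp del: psi_Cons upt_Suc)+
  show "block_in B ((a # u @ [a]) ! s) ((b # v @ [b]) ! s) ((a # u @ [a]) ! Suc s) ((b # v @ [b]) ! Suc s)"
    unfolding w using admissible_rect_block[OF U(6), of 0 s] s by (simp del: upt_Suc)
qed

theorem theorem4p9:
  fixes p :: nat and B :: "(int \<times> int \<Rightarrow> nat) set"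
  assumes "p \<ge> 2"
    and "B \<subseteq> patterns p (rect 2 2 (0, 0))"
    and "non_degenerated p (H_matrix p B 2)"
    and "non_degenerated p (V_matrix p B 2)"
    and "(\<exists>m \<beta>s K. S_invariant_diagonal_cycle p B m \<beta>s K \<and>
            (\<forall>n. 2 \<le> n \<and> n \<le> length \<beta>s + 1 \<longrightarrow>
              primitive_mat (mat_set_sum (p ^ (n - 1)) (\<lambda>l. H_elementary p B m n (hd \<beta>s) l) K)))
         \<or> (\<exists>I J m \<alpha> K L. commutative_cycle_pair p I J \<and> cycle_pair_index p I J = (m, \<alpha>, K, L) \<and>
              H_primitive_pair p B I J \<and>
              (entry (S_conn p B m \<alpha> \<alpha>) K L = 1 \<or> entry (S_conn p B m \<alpha> \<alpha>) L K = 1))"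
    and "(\<exists>m \<beta>s K. W_invariant_diagonal_cycle p B m \<beta>s K \<and>
            (\<forall>n. 2 \<le> n \<and> n \<le> length \<beta>s + 1 \<longrightarrow>
              primitive_mat (mat_set_sum (p ^ (n - 1)) (\<lambda>l. V_elementary p B m n (hd \<beta>s) l) K)))
         \<or> (\<exists>I J m \<alpha> K L. commutative_cycle_pair p I J \<and> cycle_pair_index p I J = (m, \<alpha>, K, L) \<and>
              V_primitive_pair p B I J \<and>
              (entry (W_conn p B m \<alpha> \<alpha>) K L = 1 \<or> entry (W_conn p B m \<alpha> \<alpha>) L K = 1))"
  shows "topologically_mixing (shift_space p B)"
proof (rule topologically_mixing_shift_space)
  have p: "0 < p" using assms(1) by simp
  show H: "fillable p (block_in B)"
    by (rule fillable_of_non_degenerated[OF p realizes_H_matrix assms(3)])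
  show V: "fillable p (transposed (block_in B))"
    by (rule fillable_of_non_degenerated[OF p realizes_V_matrix assms(4)])
  show "uniformly_connected p (block_in B)"
  proof (rule uniformly_connected_of_cycles[OF H realizes_H_matrix conn_realizes_S_conn])
    from assms(5) show "(\<exists>m \<beta>s K. invariant_diagonal_cycle p (S_conn p B) m \<beta>s K \<and>
            (\<forall>n. 2 \<le> n \<and> n \<le> length \<beta>s + 1 \<longrightarrow> primitive_mat (mat_set_sum (p ^ (n - 1))
              (\<lambda>l. elementary p (p ^ (n - 1)) (H_matrix p B n) m (hd \<beta>s) l) K)))
         \<or> (\<exists>I J m \<alpha> K L. commutative_cycle_pair p I J \<and> cycle_pair_index p I J = (m, \<alpha>, K, L) \<and>
              primitive_mat (elementary p p (H_matrix p B 2) m \<alpha> K) \<and>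
              primitive_mat (elementary p p (H_matrix p B 2) m \<alpha> L) \<and>
              (entry (S_conn p B m \<alpha> \<alpha>) K L = 1 \<or> entry (S_conn p B m \<alpha> \<alpha>) L K = 1))"
      unfolding S_invariant_diagonal_cycle_def H_elementary_def H_primitive_pair_def
      by (elim disjE) (blast, force)
  qed
  show "uniformly_connected p (transposed (block_in B))"
  proof (rule uniformly_connected_of_cycles[OF V realizes_V_matrix conn_realizes_W_conn])
    from assms(6) show "(\<exists>m \<beta>s K. invariant_diagonal_cycle p (W_conn p B) m \<beta>s K \<and>
            (\<forall>n. 2 \<le> n \<and> n \<le> length \<beta>s + 1 \<longrightarrow> primitive_mat (mat_set_sum (p ^ (n - 1))
              (\<lambda>l. elementary p (p ^ (n - 1)) (V_matrix p B n) m (hd \<beta>s) l) K)))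
         \<or> (\<exists>I J m \<alpha> K L. commutative_cycle_pair p I J \<and> cycle_pair_index p I J = (m, \<alpha>, K, L) \<and>
              primitive_mat (elementary p p (V_matrix p B 2) m \<alpha> K) \<and>
              primitive_mat (elementary p p (V_matrix p B 2) m \<alpha> L) \<and>
              (entry (W_conn p B m \<alpha> \<alpha>) K L = 1 \<or> entry (W_conn p B m \<alpha> \<alpha>) L K = 1))"
      unfolding W_invariant_diagonal_cycle_def V_elementary_def V_primitive_pair_def
      by (elim disjE) (blast, force)
  qed
qed

end
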